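(* There are absolute constants $c_1,c_2>0$ such that for all integers $n>k\ge 6$, \[ \left(\frac{c_1}{k}\right)^{\lfloor k/3\rfloor} n^{\lfloor k/3\rfloor} \le h_k(n)\le \left(\frac{c_2}{k}\right)^{\lceil k/2\rceil} n^{\lceil k/2\rceil}, \] where $h_k(n)$ denotes the maximum number of $k$-holes determined by a planar point set in general position, of size at most $n$, and containing no $(k+1)$-hole.
   Context: A finite point set in the plane $\mathbb{R}^2$ is in convex position if it is the vertex set of a convex polygon, and is in general position if no three of its points are collinear. Given a finite point set $P\subset\mathbb{R}^2$ and an integer $r\ge 3$, an $r$-element subset $X\subset P$ is called an $r$-hole (of $P$) if the points of $X$ are in convex position and the interior of $\mathrm{conv}(X)$ contains no point of $P$. The number of $k$-holes determined by $P$ is the number of $k$-element subsets of $P$ that are $k$-holes of $P$. *)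

theory Defs
  imports "HOL-Analysis.Analysis"
begin

definition general_position :: "(real^2) set \<Rightarrow> bool" where
  "general_position P \<longleftrightarrow> (\<forall>T\<subseteq>P. card T = 3 \<longrightarrow> \<not> collinear T)"

text \<open>A convex polygon is a polytope of affine dimension 2; its vertices are its extreme points.\<close>

definition convex_position :: "(real^2) set \<Rightarrow> bool" where
  "convex_position S \<longleftrightarrow>
     (\<exists>C. polytope C \<and> aff_dim C = 2 \<and> S = {v. v extreme_point_of C})"

definition holes :: "nat \<Rightarrow> (real^2) set \<Rightarrow> (real^2) set set" where
  "holes r P =
     {X. X \<subseteq> P \<and> card X = r \<and> convex_position X \<and> interior (convex hull X) \<inter> P = {}}"

definition hole_counts :: "nat \<Rightarrow> nat \<Rightarrow> nat set" where
  "hole_counts k n =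
     {card (holes k P) | P. finite P \<and> general_position P \<and> card P \<le> n \<and> holes (k + 1) P = {}}"

definition max_holes :: "nat \<Rightarrow> nat \<Rightarrow> nat" where
  "max_holes k n = Max (hole_counts k n)"

text \<open>The maximum in \<^const>\<open>max_holes\<close> ranges over a finite nonempty set, hence is attained.\<close>

lemma finite_hole_counts: "finite (hole_counts k n)"
proof (rule finite_subset)
  show "hole_counts k n \<subseteq> {..2 ^ n}"
  proof
    fix m assume "m \<in> hole_counts k n"
    then obtain P where P: "finite P" "card P \<le> n" and m: "m = card (holes k P)"
      by (auto simp: hole_counts_def)
    have "card (holes k P) \<le> card (Pow P)"
      using P by (intro card_mono) (auto simp: holes_def)
    also have "\<dots> = 2 ^ card P" using P by (simp add: card_Pow)
    also have "\<dots> \<le> 2 ^ n" using P by simp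
    finally show "m \<in> {..2 ^ n}" using m by simp
  qed
qed simp

lemma hole_counts_nonempty: "hole_counts k n \<noteq> {}"
proof -
  have "holes (k + 1) {} = {}" by (auto simp: holes_def)
  then have "card (holes k {}) \<in> hole_counts k n"
    unfolding hole_counts_def by (auto simp: general_position_def intro!: exI[of _ "{}"])
  then show ?thesis by blast
qed

end

theory Submission imports Defs begin

text \<open>
  Upper bound. List a \<open>k\<close>-hole counterclockwise as \<open>x\<^sub>0, x\<^sub>1, \<dots>\<close>. If \<open>t, v, u, z\<close> are consecutive on one hole and
  \<open>t, v, u', z\<close> on another, with \<open>u \<noteq> u'\<close>, then one of the two holes can be enlarged by a vertex between \<open>v\<close> and
  \<open>u\<close> (or \<open>u'\<close>). Without \<open>(k+1)\<close>-holes, the vertex between \<open>v\<close> and \<open>z\<close> is therefore determined by \<open>t, v, z\<close>.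
  For odd \<open>k\<close>, a choice of every second vertex that includes one pair of neighbours determines the hole. For even \<open>k\<close>,
  take \<open>k / 2\<close> vertices that leave one gap of size 0, one gap \<open>x\<^sub>1, x\<^sub>2\<close> of size 2, and gaps of size 1 otherwise;
  they determine the hole if, after deletion of \<open>x\<^sub>2\<close>, no vertex can be inserted before \<open>x\<^sub>1\<close>. The mirror
  image of this condition forbids inserting a vertex after \<open>x\<^sub>3\<close>. One of the two must hold: two such insertions,
  both paid for by the single deletion of \<open>x\<^sub>2\<close>, would produce a \<open>(k+1)\<close>-hole.

  Lower bound. Place \<open>k div 3\<close> flat Horton sets along tangents of a parabola, plus \<open>k mod 3\<close> single points, such that
  every line through two points of one cluster has all other clusters above it. A hole that meets two clusters meets each
  of them in a set no pair of which has a cluster point above its connecting segment; in a Horton set such a set has at most three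
  elements, and there are linearly many of size three. A hole inside one cluster has at most six vertices.
\<close>

section \<open>Counterclockwise lists for an abstract orientation\<close>

lemma mod_add_diff_self: "d \<le> j \<Longrightarrow> j < k \<Longrightarrow> (j + k - d) mod k = j - d" for j k d :: nat
  by (metis add_diff_assoc2 less_imp_diff_less mod_add_self2 mod_less)

text \<open>The last axiom says that \<open>ori e f\<close> is affine, in barycentric coordinates with respect to \<open>a, b, c\<close>. The axioms are invariant
  under negation, which gives access to mirror images.\<close>

locale orientation =
  fixes ori :: "'a \<Rightarrow> 'a \<Rightarrow> 'a \<Rightarrow> real"
  assumes cyc: "ori a b c = ori b c a"
    and swap: "ori a b c = - ori b a c"
    and bary: "ori a b p + ori b c p + ori c a p = ori a b c"
    and affine: "ori a b c * ori e f p =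
      ori b c p * ori e f a + ori c a p * ori e f b + ori a b p * ori e f c"
begin

lemma ori_same [simp]: "ori a a b = 0" "ori a b a = 0" "ori b a a = 0"
  using swap[of a a b] swap[of b b a] cyc[of a a b] cyc[of a b a] by auto

definition inside :: "'a \<Rightarrow> 'a \<Rightarrow> 'a \<Rightarrow> 'a \<Rightarrow> bool" where
  "inside a b c p \<longleftrightarrow> ori a b p > 0 \<and> ori b c p > 0 \<and> ori c a p > 0"

text \<open>\<open>inside\<close> forces a counterclockwise triangle and all ordered triples are
  tested, so no orientation has to be chosen. As \<open>P\<close> may contain \<open>X\<close>, for
  \<open>X \<subseteq> P\<close> this expresses emptiness and convex position at once;
  \<open>void X X\<close> is convex position alone.\<close>

definition void :: "'a set \<Rightarrow> 'a set \<Rightarrow> bool" where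
  "void P X \<longleftrightarrow> (\<forall>a\<in>X. \<forall>b\<in>X. \<forall>c\<in>X. \<forall>p\<in>P. \<not> inside a b c p)"

definition genpos :: "'a set \<Rightarrow> bool" where
  "genpos P \<longleftrightarrow> (\<forall>a\<in>P. \<forall>b\<in>P. \<forall>c\<in>P. ori a b c = 0 \<longrightarrow> a = b \<or> b = c \<or> a = c)"

text \<open>\<open>sorted_wrt\<close> compares all pairs, so every index-increasing triple is
  positive. Testing consecutive triples only would also admit star polygons.\<close>

primrec ccw :: "'a list \<Rightarrow> bool" where
  "ccw [] \<longleftrightarrow> True"
| "ccw (x # xs) \<longleftrightarrow> sorted_wrt (\<lambda>b c. ori x b c > 0) xs \<and> ccw xs"

definition left_of_edges :: "'a list \<Rightarrow> 'a \<Rightarrow> bool" where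
  "left_of_edges xs p \<longleftrightarrow> successively (\<lambda>a b. ori a b p > 0) (xs @ [hd xs])"

lemma inside_ori: "inside a b c p \<Longrightarrow> ori a b c > 0"
  using bary[of a b p c] by (auto simp: inside_def)

lemma void_mono: "void P X \<Longrightarrow> Y \<subseteq> X \<Longrightarrow> void P Y"
  unfolding void_def by blast

lemma genpos_mono: "genpos P \<Longrightarrow> Q \<subseteq> P \<Longrightarrow> genpos Q"
  unfolding genpos_def by blast

lemma ccw_snoc: "ccw (xs @ [y]) \<longleftrightarrow> ccw xs \<and> sorted_wrt (\<lambda>a b. ori a b y > 0) xs"
  by (induction xs) (auto simp: sorted_wrt_append)

lemma ccw_rotate1: "ccw (x # xs) \<longleftrightarrow> ccw (xs @ [x])"
proof -
  have "(\<lambda>b c. ori x b c > 0) = (\<lambda>b c. ori b c x > 0)" by (metis cyc)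
  then show ?thesis by (auto simp: ccw_snoc)
qed

lemma ccw_append_commute: "ccw (xs @ ys) \<longleftrightarrow> ccw (ys @ xs)"
proof (induction xs arbitrary: ys)
  case (Cons x xs)
  then show ?case using ccw_rotate1[of x "xs @ ys"] Cons[of "ys @ [x]"] by simp
qed simp

lemma ccw_rotate: "ccw (rotate n xs) \<longleftrightarrow> ccw xs"
  using ccw_append_commute[of "drop (n mod length xs) xs" "take (n mod length xs) xs"]
  by (simp add: rotate_drop_take)

lemma ccw_iff_nth:
  "ccw xs \<longleftrightarrow> (\<forall>i j l. i < j \<and> j < l \<and> l < length xs \<longrightarrow> ori (xs!i) (xs!j) (xs!l) > 0)"
proof (induction xs)
  case (Cons x xs)
  show ?case
  proof
    assume L: "ccw (x # xs)"
    show "\<forall>i j l. i < j \<and> j < l \<and> l < length (x # xs) \<longrightarrow>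
        ori ((x # xs)!i) ((x # xs)!j) ((x # xs)!l) > 0"
    proof (intro allI impI)
      fix i j l assume *: "i < j \<and> j < l \<and> l < length (x # xs)"
      then obtain j' l' where jl: "j = Suc j'" "l = Suc l'"
        by (metis Suc_pred gr_implies_not0 not_gr_zero)
      show "ori ((x # xs)!i) ((x # xs)!j) ((x # xs)!l) > 0"
        using L * Cons jl by (cases i) (auto simp: sorted_wrt_iff_nth_less)
    qed
  next
    assume R: "\<forall>i j l. i < j \<and> j < l \<and> l < length (x # xs) \<longrightarrow>
        ori ((x # xs)!i) ((x # xs)!j) ((x # xs)!l) > 0"
    have "ori (xs!i) (xs!j) (xs!l) > 0" if "i < j \<and> j < l \<and> l < length xs" for i j l
      using R[rule_format, of "Suc i" "Suc j" "Suc l"] that by simp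
    moreover have "ori x (xs!j) (xs!l) > 0" if "j < l" "l < length xs" for j l
      using R[rule_format, of 0 "Suc j" "Suc l"] that by simp
    ultimately show "ccw (x # xs)" using Cons by (simp add: sorted_wrt_iff_nth_less)
  qed
qed simp

lemma ccw_map_nth:
  assumes "ccw xs" "sorted_wrt (<) I" "set I \<subseteq> {..<length xs}"
  shows "ccw (map ((!) xs) I)"
  unfolding ccw_iff_nth
proof (intro allI impI)
  fix i j l assume "i < j \<and> j < l \<and> l < length (map ((!) xs) I)"
  then have "I ! i < I ! j" "I ! j < I ! l" "I ! l < length xs" 
    and "i < length I" "j < length I" "l < length I"
    using assms(2,3) nth_mem[of l I] by (auto simp: sorted_wrt_iff_nth_less simp del: nth_mem)
  then show "ori (map ((!) xs) I ! i) (map ((!) xs) I ! j) (map ((!) xs) I ! l) > 0"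
    using assms(1) by (simp add: ccw_iff_nth)
qed

lemma ccw_distinct:
  assumes "ccw xs" "length xs \<ge> 3" shows "distinct xs"
  unfolding distinct_conv_nth
proof (intro allI impI)
  have *: "xs ! i \<noteq> xs ! j" if "i < j" "j < length xs" for i j
  proof (cases "j < length xs - 1")
    case True
    then have "ori (xs!i) (xs!j) (xs!(length xs - 1)) > 0"
      using assms that by (auto simp: ccw_iff_nth)
    then show ?thesis by auto
  next
    case j: False
    show ?thesis
    proof (cases "i > 0")
      case True
      then have "ori (xs!0) (xs!i) (xs!j) > 0"
        using assms that by (auto simp: ccw_iff_nth)
      then show ?thesis by auto
    next
      case False
      then have "ori (xs!i) (xs!1) (xs!j) > 0"
        using assms that j by (auto simp: ccw_iff_nth)
      then show ?thesis by auto
    qed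
  qed
  fix i j assume "i < length xs" "j < length xs" "i \<noteq> j"
  then show "xs ! i \<noteq> xs ! j" using *[of i j] *[of j i] by (metis linorder_neqE_nat)
qed

text \<open>Seen from the fixed vertex \<open>x\<close>, the others are sorted by angle, and
  antisymmetry of \<open>ori x\<close> leaves only one such order. This recovers a list from its set
  and its head.\<close>

lemma ccw_unique:
  assumes "ccw (x # xs)" "ccw (x # ys)" "set xs = set ys" "distinct xs" "distinct ys"
  shows "xs = ys"
proof -
  have "sorted_wrt (\<lambda>b c. ori x b c > 0) xs" "sorted_wrt (\<lambda>b c. ori x b c > 0) ys"
    using assms by auto
  then show ?thesis using assms(3-5)
  proof (induction xs arbitrary: ys)
    case (Cons a xs)
    then obtain b ys' where ys: "ys = b # ys'" by (cases ys) auto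
    have "a = b"
    proof (rule ccontr)
      assume "a \<noteq> b"
      then have "b \<in> set xs" "a \<in> set ys'" using Cons.prems ys by auto
      then have "ori x a b > 0" "ori x b a > 0" using Cons.prems ys by auto
      then show False using swap[of x a b] cyc[of x b a] cyc[of b a x] by linarith
    qed
    moreover have "xs = ys'"
      using Cons.IH[of ys'] Cons.prems ys \<open>a = b\<close> by (auto simp: insert_ident)
    ultimately show ?case using ys by simp
  qed simp
qed

section \<open>Points inside a convex polygon\<close>

text \<open>Rotating the list so that \<open>f\<close> comes first and \<open>e\<close> last makes
  \<open>f, g, e\<close> an index-increasing triple for every other vertex \<open>g\<close>.\<close>

lemma ccw_edge_cases:
  assumes "ccw xs" "xs \<noteq> []" "xs @ [hd xs] = us @ e # f # vs" "g \<in> set xs"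
  shows "g = e \<or> g = f \<or> ori e f g > 0"
proof (cases vs rule: rev_cases)
  case Nil
  then have f: "f = hd xs" and xs: "xs = us @ [e]" using assms by auto
  show ?thesis
  proof (cases us)
    case Nil
    then show ?thesis using xs assms by auto
  next
    case (Cons a us')
    then have "xs = f # us' @ [e]" using xs f by auto
    then have "g = e \<or> g = f \<or> ori f g e > 0"
      using assms by (auto simp: sorted_wrt_append)
    then show ?thesis using cyc[of e f g] by auto
  qed
next
  case (snoc vs' w)
  then have xs: "xs = (us @ [e]) @ (f # vs')" using assms by auto
  then have "ccw ((f # vs') @ (us @ [e]))" using assms ccw_append_commute by metis
  then have "g = e \<or> g = f \<or> ori f g e > 0"
    using assms(4) xs by (auto simp: sorted_wrt_append)
  then show ?thesis using cyc[of e f g] by auto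
qed

text \<open>\<open>ori e f\<close> is affine, nonnegative at \<open>a, b, c\<close>, and positive at
  one of them because three distinct points cannot all lie in \<open>{e, f}\<close>. Hence it is
  positive at \<open>p\<close>, whose barycentric coordinates are all positive.\<close>

lemma inside_left_of_edges:
  assumes "ccw xs" "a \<in> set xs" "b \<in> set xs" "c \<in> set xs" "inside a b c p"
  shows "left_of_edges xs p"
  unfolding left_of_edges_def successively_conv_nth
proof (intro allI impI)
  fix i assume i: "Suc i < length (xs @ [hd xs])"
  let ?L = "xs @ [hd xs]"
  define e f where "e = ?L ! i" and "f = ?L ! Suc i"
  have ne: "xs \<noteq> []" using assms by auto
  have "?L = take i ?L @ e # f # drop (Suc (Suc i)) ?L"
    using i id_take_nth_drop[of i ?L] Cons_nth_drop_Suc[of "Suc i" ?L] by (simp add: e_def f_def)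
  then have *: "g = e \<or> g = f \<or> ori e f g > 0" if "g \<in> set xs" for g
    using ccw_edge_cases[OF assms(1) ne] that by blast
  then have ge: "ori e f g \<ge> 0" if "g \<in> set xs" for g
    using that by (metis less_eq_real_def ori_same(2,3))
  have abc: "ori a b c > 0" using inside_ori assms(5) .
  then have "a \<noteq> b" "b \<noteq> c" "a \<noteq> c" by auto
  then have "ori e f a > 0 \<or> ori e f b > 0 \<or> ori e f c > 0" using * assms(2-4) by metis
  then have "ori a b c * ori e f p > 0"
    using ge[OF assms(2)] ge[OF assms(3)] ge[OF assms(4)] assms(5)
    unfolding affine[of a b c e f p] inside_def
    by (smt (verit) mult_pos_pos mult_nonneg_nonneg)
  then show "ori e f p > 0" using abc by (simp add: zero_less_mult_iff)
qed

text \<open>Fan triangulation from the head \<open>x\<close>: along the boundary,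
  \<open>ori x b p\<close> starts positive and ends nonpositive, and the edge \<open>b, c\<close>
  where the sign changes gives the triangle \<open>x, b, c\<close> around \<open>p\<close>. General
  position rules out the value zero.\<close>

lemma fan:
  assumes P: "genpos P" "set xs \<subseteq> P" "p \<in> P" and "xs \<noteq> []" "left_of_edges xs p"
  shows "\<exists>a\<in>set xs. \<exists>b\<in>set xs. \<exists>c\<in>set xs. inside a b c p"
proof -
  obtain x ys where xs: "xs = x # ys" using assms by (cases xs) auto
  have "ys \<noteq> []" using assms xs by (auto simp: left_of_edges_def)
  then obtain y zs where ys: "ys = y # zs" by (cases ys) auto
  have path: "\<exists>b\<in>set (y # zs). \<exists>c\<in>set (y # zs). ori x b p > 0 \<and> ori b c p > 0 \<and> ori x c p \<le> 0"
    if "successively (\<lambda>a b. ori a b p > 0) (y # zs)" "ori x y p > 0" "ori x (last (y # zs)) p \<le> 0"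
    for y zs
    using that
  proof (induction zs arbitrary: y)
    case (Cons z zs)
    show ?case
    proof (cases "ori x z p > 0")
      case True
      then have "\<exists>b\<in>set (z # zs). \<exists>c\<in>set (z # zs). ori x b p > 0 \<and> ori b c p > 0 \<and> ori x c p \<le> 0"
        using Cons.IH[of z] Cons.prems by simp
      then show ?thesis by (meson list.set_intros(2))
    next
      case False
      then have "ori x y p > 0 \<and> ori y z p > 0 \<and> ori x z p \<le> 0" using Cons.prems by simp
      then show ?thesis by (meson list.set_intros)
    qed
  qed simp
  have "successively (\<lambda>a b. ori a b p > 0) ([x] @ (y # zs) @ [x])"
    using assms(5) unfolding xs ys left_of_edges_def by simp
  then have s: "successively (\<lambda>a b. ori a b p > 0) (y # zs)" "ori x y p > 0" "ori (last (y # zs)) x p > 0"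
    unfolding successively_append_iff[of _ "[x]"] successively_append_iff[of _ "y # zs"] by simp_all
  moreover have "ori x (last (y # zs)) p \<le> 0" using s(3) swap[of x "last (y # zs)" p] by linarith
  ultimately obtain b c where bc: "b \<in> set (y # zs)" "c \<in> set (y # zs)"
    "ori x b p > 0" "ori b c p > 0" "ori x c p \<le> 0"
    using path[of y zs] by blast
  have "ori x c p \<noteq> 0"
  proof
    assume "ori x c p = 0"
    then have "x = c \<or> c = p \<or> x = p" using P bc xs ys unfolding genpos_def by auto
    then show False using bc swap[of x b p] by (smt (verit) ori_same)
  qed
  then have "ori c x p > 0" using bc swap[of x c p] by linarith
  then have "inside x b c p" using bc unfolding inside_def by simp
  then show ?thesis using bc xs ys by (meson list.set_intros)
qed

section \<open>Inserting a vertex, and listing a set in convex position\<close>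

text \<open>Local convexity suffices: \<open>y\<close> lies beyond the edge from \<open>v\<close> to
  \<open>u\<close> and on the inner side of the two neighbouring edges. Each further triple is an
  affine function expanded over a triangle in which the only negative coordinate is multiplied by
  zero.\<close>

lemma ccw_insert:
  assumes c: "ccw (u # ws @ [v])" and "ws \<noteq> []"
    and y: "ori v y u > 0" "ori (last ws) v y > 0" "ori u (hd ws) y > 0"
  shows "ccw (u # ws @ [v, y])"
proof -
  have uwv: "ori u x v > 0" if "x \<in> set ws" for x
    using c that by (auto simp: sorted_wrt_append)
  have w3: "sorted_wrt (\<lambda>a b. ori a b v > 0) ws" "sorted_wrt (\<lambda>a b. ori u a b > 0) ws"
    using c by (auto simp: ccw_snoc sorted_wrt_append)
  have v: "ori x v y > 0" if "x \<in> set ws" for x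
  proof (cases "x = last ws")
    case False
    define t where "t = last ws"
    have ws: "ws = butlast ws @ [t]" using assms(2) t_def by simp
    then have "x \<in> set (butlast ws)" using that False t_def by (metis Un_iff empty_iff set_ConsD set_append set_empty2)
    then have "ori x t v > 0" using w3(1) ws by (metis list.set_intros(1) sorted_wrt_append)
    moreover have "ori u t v > 0" using uwv ws by (metis in_set_conv_decomp)
    moreover have "ori u x v > 0" using uwv that .
    ultimately have "ori v u t * ori v y x > 0"
      unfolding affine[of v u t v y x] using y t_def cyc[of x t v] cyc[of v y t] cyc[of y t v]
        cyc[of u x v] cyc[of x v u] by (auto intro!: add_pos_pos mult_pos_pos)
    moreover have "ori v u t > 0" using \<open>ori u t v > 0\<close> cyc[of v u t] by simp
    ultimately show ?thesis using cyc[of v y x] cyc[of y x v] by (simp add: zero_less_mult_iff)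
  qed (use y in auto)
  have u: "ori u x y > 0" if "x \<in> set ws" for x
  proof (cases "x = hd ws")
    case False
    define z where "z = hd ws"
    have ws: "ws = z # tl ws" using assms(2) z_def by simp
    then have "x \<in> set (tl ws)" using that False z_def by (metis set_ConsD)
    then have "ori u z x > 0" using w3(2) ws by (metis sorted_wrt.simps(2))
    moreover have "ori u z v > 0" using uwv ws by (metis list.set_intros(1))
    moreover have "ori u x v > 0" using uwv that .
    moreover have "ori y u z > 0" using y z_def cyc[of y u z] by simp
    moreover have "ori y u v > 0" using y cyc[of y u v] cyc[of u v y] by simp
    ultimately have "ori u z v * ori y u x > 0"
      unfolding affine[of u z v y u x] using cyc[of v u x]
      by (auto intro!: add_pos_pos mult_pos_pos)
    then show ?thesis using \<open>ori u z v > 0\<close> cyc[of y u x] by (simp add: zero_less_mult_iff)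
  qed (use y in auto)
  have "sorted_wrt (\<lambda>a b. ori a b y > 0) ws"
  proof (rule sorted_wrt_mono_rel[rotated])
    show "sorted_wrt (\<lambda>a b. ori a b v > 0 \<and> ori u a b > 0) ws"
      using w3 by (auto simp: sorted_wrt_iff_nth_less)
  next
    fix a b assume a: "a \<in> set ws" "b \<in> set ws" "ori a b v > 0 \<and> ori u a b > 0"
    have "ori b v u > 0" using uwv[OF a(2)] cyc[of b v u] cyc[of v u b] by simp
    moreover have "ori b v u * ori a b y > 0"
      unfolding affine[of b v u a b y] using a u[OF a(2)] v[OF a(2)] cyc[of a b u] cyc[of b u a]
      by (auto intro!: add_pos_pos mult_pos_pos)
    ultimately show "ori a b y > 0" by (simp add: zero_less_mult_iff)
  qed
  then have "sorted_wrt (\<lambda>a b. ori a b y > 0) (u # ws @ [v])"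
    using u v y cyc[of u v y] by (auto simp: sorted_wrt_append)
  then show ?thesis using c ccw_snoc[of "u # ws @ [v]" y] by simp
qed

text \<open>The enlarged polygon is the old one plus the triangle \<open>v, y, u\<close>. A point
  inside it is in the old polygon or in the triangle, according to its side of the line
  \<open>v u\<close>; on the line itself it would violate general position.\<close>

lemma void_insert:
  assumes P: "genpos P" "set (u # ws @ [v]) \<subseteq> P"
    and c: "ccw (u # ws @ [v, y])" and e: "void P (set (u # ws @ [v]))"
    and t: "\<And>p. p \<in> P \<Longrightarrow> \<not> inside v y u p"
  shows "void P (set (u # ws @ [v, y]))"
  unfolding void_def
proof (intro ballI notI)
  fix a b d p assume "a \<in> set (u # ws @ [v, y])" "b \<in> set (u # ws @ [v, y])"
    "d \<in> set (u # ws @ [v, y])" and p: "p \<in> P" and "inside a b d p"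
  then have l: "left_of_edges (u # ws @ [v, y]) p" using inside_left_of_edges c by blast
  then have "successively (\<lambda>a b. ori a b p > 0) ((u # ws @ [v]) @ [y, u])"
    unfolding left_of_edges_def by simp
  then have vy: "ori v y p > 0" "ori y u p > 0"
    and s: "successively (\<lambda>a b. ori a b p > 0) (u # ws @ [v])"
    unfolding successively_append_iff[of _ "u # ws @ [v]"] by simp_all
  consider "ori v u p > 0" | "ori v u p = 0" | "ori u v p > 0"
    using swap[of v u p] by linarith
  then show False
  proof cases
    case 1
    have "successively (\<lambda>a b. ori a b p > 0) ((u # ws @ [v]) @ [u])"
      unfolding successively_append_iff[of _ "u # ws @ [v]"] using s 1 by simp
    then have "left_of_edges (u # ws @ [v]) p" unfolding left_of_edges_def by simp
    then show False using fan[OF P p] e p unfolding void_def by blast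
  next
    case 2
    then have "v = u \<or> u = p \<or> v = p" using P p unfolding genpos_def by auto
    then show False using vy swap[of u y p] by (smt (verit) ori_same)
  next
    case 3
    then show False using t[OF p] vy unfolding inside_def by auto
  qed
qed

text \<open>Any edge can be made the closing edge, the only place where \<open>ccw_insert\<close>
  adds a vertex.\<close>

lemma edge_rotation:
  assumes "xs @ [hd xs] = us @ e # f # vs" "length xs \<ge> 2"
  shows "\<exists>as bs ws. xs = as @ bs \<and> bs @ as = f # ws @ [e]"
proof (cases vs rule: rev_cases)
  case Nil
  then have f: "f = hd xs" and xs: "xs = us @ [e]" using assms by auto
  then obtain us' where "us = f # us'" using assms by (cases us) auto
  then have "xs = [] @ xs \<and> xs @ [] = f # us' @ [e]" using xs by simp
  then show ?thesis by blast
next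
  case (snoc vs' w)
  then have "xs = (us @ [e]) @ (f # vs')" using assms by auto
  moreover have "(f # vs') @ (us @ [e]) = f # (vs' @ us) @ [e]" by simp
  ultimately show ?thesis by blast
qed

text \<open>Induction on the cardinality: delete a point \<open>y\<close> and list the rest. By
  voidness \<open>y\<close> is not inside that polygon, so it lies beyond some edge from
  \<open>e\<close> to \<open>f\<close>, and there it can be inserted.\<close>

lemma ccw_list_exists:
  assumes "genpos X" "finite X" "card X \<ge> 3" "void X X"
  shows "\<exists>xs. ccw xs \<and> set xs = X \<and> length xs = card X"
  using assms
proof (induction "card X" arbitrary: X rule: less_induct)
  case less
  show ?case
  proof (cases "card X = 3")
    case True
    then obtain a b c where X: "X = {a, b, c}" "a \<noteq> b" "b \<noteq> c" "a \<noteq> c"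
      by (auto simp: card_3_iff)
    then have "ori a b c \<noteq> 0" using less.prems(1) unfolding genpos_def by blast
    then consider "ori a b c > 0" | "ori b a c > 0" using swap[of a b c] by linarith
    then show ?thesis
    proof cases
      case 1
      then have "ccw [a, b, c]" by simp
      then show ?thesis using X True by (intro exI[of _ "[a, b, c]"]) auto
    next
      case 2
      then have "ccw [b, a, c]" by simp
      then show ?thesis using X True by (intro exI[of _ "[b, a, c]"]) auto
    qed
  next
    case False
    then obtain y Y where X: "X = insert y Y" "y \<notin> Y" and cY: "card X = Suc (card Y)"
      using less.prems(2,3) by (metis card_Suc_eq_finite card_le_Suc_iff not_numeral_le_zero old.nat.exhaust)
    have Y: "card Y \<ge> 3" "finite Y" using False cY less.prems X by auto
    have "void Y Y" using less.prems(4) X unfolding void_def by blast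
    then obtain xs where xs: "ccw xs" "set xs = Y" "length xs = card Y"
      using less.hyps[of Y] cY Y genpos_mono[OF less.prems(1), of Y] X(1) by fastforce
    have ne: "xs \<noteq> []" using xs Y by auto
    have "\<not> left_of_edges xs y"
    proof
      assume "left_of_edges xs y"
      then have "\<exists>a\<in>set xs. \<exists>b\<in>set xs. \<exists>c\<in>set xs. inside a b c y"
        using fan[OF less.prems(1) _ _ ne] xs X by blast
      then show False using less.prems(4) xs X unfolding void_def by blast
    qed
    then obtain i where i: "Suc i < length (xs @ [hd xs])"
      "\<not> ori ((xs @ [hd xs]) ! i) ((xs @ [hd xs]) ! Suc i) y > 0"
      unfolding left_of_edges_def successively_conv_nth by blast
    define e f where "e = (xs @ [hd xs]) ! i" and "f = (xs @ [hd xs]) ! Suc i"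
    have "xs @ [hd xs] = take i (xs @ [hd xs]) @ e # f # drop (Suc (Suc i)) (xs @ [hd xs])"
      using i id_take_nth_drop[of i "xs @ [hd xs]"] Cons_nth_drop_Suc[of "Suc i" "xs @ [hd xs]"]
      by (simp add: e_def f_def)
    then obtain as bs ws where r: "xs = as @ bs" "bs @ as = f # ws @ [e]"
      using edge_rotation xs(3) Y(1) by (metis One_nat_def Suc_1 Suc_leD numeral_3_eq_3)
    have c: "ccw (f # ws @ [e])" using r xs(1) ccw_append_commute by metis
    have set: "set (f # ws @ [e]) = Y" and len: "length (f # ws @ [e]) = card Y"
      using r xs by (metis set_append sup_commute, metis length_append add.commute)
    have wne: "ws \<noteq> []" using len Y by auto
    have d: "distinct (f # ws @ [e])" using ccw_distinct[OF c] len Y by simp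
    have mem: "e \<in> X" "f \<in> X" "y \<in> X" "hd ws \<in> X" "last ws \<in> X" and ny: "y \<noteq> e" "y \<noteq> f" "y \<noteq> hd ws" "y \<noteq> last ws"
      using set X wne hd_in_set[OF wne] last_in_set[OF wne] by auto
    have dist: "e \<noteq> f" "f \<noteq> hd ws" "e \<noteq> last ws" using d wne hd_in_set[OF wne] last_in_set[OF wne] by auto
    have nz: "ori a b y \<noteq> 0" if "a \<in> X" "b \<in> X" "a \<noteq> b" "a \<noteq> y" "b \<noteq> y" for a b
      using less.prems(1) mem(3) that unfolding genpos_def by blast
    have "ori e f y < 0" using i nz[OF mem(1,2)] dist ny unfolding e_def[symmetric] f_def[symmetric]
      by (metis linorder_neqE_linordered_idom)
    then have 1: "ori e y f > 0" using cyc[of e y f] cyc[of y f e] swap[of e f y] by linarith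
    have w: "ori f x e > 0" if "x \<in> set ws" for x
      using c that by (auto simp: sorted_wrt_append)
    \<comment> \<open>Otherwise \<open>e\<close> would be inside the triangle
      \<open>y, f, last ws\<close>. The triangle \<open>y, hd ws, e\<close> handles \<open>f\<close>
      in the same way.\<close>
    have 2: "ori (last ws) e y > 0"
    proof (rule ccontr)
      assume "\<not> ori (last ws) e y > 0"
      then have "ori (last ws) e y < 0" using nz[OF mem(5,1)] dist ny by force
      then have "ori (last ws) y e > 0"
        using cyc[of "last ws" y e] cyc[of y e "last ws"] swap[of "last ws" e y] by linarith
      moreover have "ori y f e > 0" using 1 cyc[of e y f] by simp
      ultimately have "inside y f (last ws) e" using w[OF last_in_set[OF wne]] by (simp add: inside_def)
      then show False using less.prems(4) mem unfolding void_def by blast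
    qed
    have 3: "ori f (hd ws) y > 0"
    proof (rule ccontr)
      assume "\<not> ori f (hd ws) y > 0"
      then have "ori f (hd ws) y < 0" using nz[OF mem(2,4)] dist ny by force
      then have "ori y (hd ws) f > 0"
        using cyc[of y "hd ws" f] swap[of f "hd ws" y] cyc[of "hd ws" f y] by linarith
      moreover have "ori (hd ws) e f > 0"
        using w[OF hd_in_set[OF wne]] cyc[of f "hd ws" e] by simp
      ultimately have "inside y (hd ws) e f" using 1 by (simp add: inside_def)
      then show False using less.prems(4) mem unfolding void_def by blast
    qed
    have "ccw (f # ws @ [e, y])" using ccw_insert[OF c wne 1 2 3] .
    then show ?thesis using set len X cY by (intro exI[of _ "f # ws @ [e, y]"]) auto
  qed
qed

section \<open>Holes as lists, and vertices forced by three neighbours\<close>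

text \<open>Every rotation of a list is in the set as well, so a hole is counted several times; for
  an upper bound this does no harm.\<close>

definition hole_lists :: "nat \<Rightarrow> 'a set \<Rightarrow> 'a list set" where
  "hole_lists k P = {xs. length xs = k \<and> set xs \<subseteq> P \<and> ccw xs \<and> void P (set xs)}"

text \<open>The new vertex always enters the gap between the last and the first vertex; other gaps
  are reached by rotating the list.\<close>

definition extendable :: "'a set \<Rightarrow> 'a list \<Rightarrow> bool" where
  "extendable P xs \<longleftrightarrow> (\<exists>y\<in>P. ccw (xs @ [y]) \<and> void P (set (xs @ [y])))"

lemma finite_hole_lists: "finite P \<Longrightarrow> finite (hole_lists k P)"
  by (rule finite_subset[OF _ finite_lists_length_eq[of P k]]) (auto simp: hole_lists_def)

lemma card_void_subsets_le:
  assumes "finite P" "genpos P" "k \<ge> 3"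
  shows "card {X. X \<subseteq> P \<and> card X = k \<and> void P X} \<le> card (hole_lists k P)"
proof -
  have "{X. X \<subseteq> P \<and> card X = k \<and> void P X} \<subseteq> set ` hole_lists k P"
  proof
    fix X assume "X \<in> {X. X \<subseteq> P \<and> card X = k \<and> void P X}"
    then have X: "X \<subseteq> P" "card X = k" "void P X" by auto
    then have "void X X" unfolding void_def by blast
    then obtain xs where "ccw xs" "set xs = X" "length xs = card X"
      using ccw_list_exists[of X] X assms genpos_mono finite_subset by blast
    then show "X \<in> set ` hole_lists k P" using X by (auto simp: hole_lists_def)
  qed
  then show ?thesis
    using finite_hole_lists[OF assms(1)] by (meson card_image_le card_mono finite_imageI order_trans)
qed

text \<open>Among all admissible new vertices, the one spanning the smallest triangle with \<open>u\<close> and \<open>v\<close> keeps the polygon void.\<close>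

lemma extendable_gap:
  assumes P: "genpos P" "finite P"
    and xs: "set (u # ws @ [v]) \<subseteq> P" "ccw (u # ws @ [v])" "void P (set (u # ws @ [v]))" "ws \<noteq> []"
    and ys: "set (u' # ws' @ [v]) \<subseteq> P" "ccw (u' # ws' @ [v])" "void P (set (u' # ws' @ [v]))" "ws' \<noteq> []"
    and eq: "hd ws' = hd ws" "last ws' = last ws"
    and u': "ori v u' u > 0"
  shows "extendable P (u # ws @ [v])"
proof -
  define z t where "z = hd ws" and "t = last ws"
  have zt: "z \<in> set ws" "t \<in> set ws" "z \<in> set ws'" "t \<in> set ws'"
    using xs(4) ys(4) eq hd_in_set last_in_set by (metis z_def t_def)+
  have o: "ori u x v > 0" if "x \<in> set ws" for x using xs(2) that by (auto simp: sorted_wrt_append)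
  have o': "ori u' x v > 0" if "x \<in> set ws'" for x using ys(2) that by (auto simp: sorted_wrt_append)
  have tv: "ori t v u' > 0" using o'[OF zt(4)] cyc[of u' t v] by simp
  have tvu: "ori t v u > 0" using o[OF zt(2)] cyc[of u t v] by simp
  have zvu: "ori z v u > 0" using o[OF zt(1)] cyc[of u z v] by simp
  \<comment> \<open>The triangle \<open>v, u', z\<close> belongs to the second hole. Two of the
    three inequalities hold, so the third fails; this puts \<open>u'\<close> on the inner side of
    the edge from \<open>u\<close> to \<open>z\<close> and makes it a candidate for
    insertion.\<close>
  have "\<not> inside v u' z u" using ys(3) zt xs(1) unfolding void_def by auto
  then have "ori u' z u \<le> 0" using u' zvu unfolding inside_def by auto
  moreover have "ori u' z u \<noteq> 0"
  proof
    assume "ori u' z u = 0"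
    moreover have "u' \<in> P" "z \<in> P" "u \<in> P" using xs(1) ys(1) zt by auto
    ultimately have "u' = z \<or> z = u \<or> u' = u" using P(1) unfolding genpos_def by blast
    then show False
    proof (elim disjE)
      assume "u' = z" then show False using o'[OF zt(3)] by simp
    next
      assume "z = u" then show False using o[OF zt(1)] by simp
    next
      assume "u' = u" then show False using u' by simp
    qed
  qed
  ultimately have uz: "ori u z u' > 0"
    using cyc[of u z u'] swap[of u' z u] by linarith
  \<comment> \<open>\<open>Q\<close> collects the points that satisfy the hypotheses of
    \<open>ccw_insert\<close>. A point of \<open>P\<close> inside the triangle
    \<open>v, y, u\<close> of a candidate \<open>y\<close> is a candidate with a smaller value of
    \<open>ori v y u\<close>, so the minimal one has an empty triangle.\<close>
  define Q where "Q = {y \<in> P. ori v y u > 0 \<and> ori t v y > 0 \<and> ori u z y > 0}"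
  have "u' \<in> Q" using u' tv uz ys(1) by (simp add: Q_def)
  moreover have "finite Q" using P(2) by (simp add: Q_def)
  ultimately obtain y where y: "y \<in> Q" "\<And>p. p \<in> Q \<Longrightarrow> ori v y u \<le> ori v p u"
    using arg_min_if_finite(1)[of Q "\<lambda>p. ori v p u"] arg_min_least[of Q _ "\<lambda>p. ori v p u"]
    by (metis emptyE)
  have e: "\<not> inside v y u p" if p: "p \<in> P" for p
  proof
    assume i: "inside v y u p"
    have vyu: "ori v y u > 0" and tvy: "ori t v y > 0" and uzy: "ori u z y > 0" using y by (auto simp: Q_def)
    have 1: "ori v p u = ori u v p" using cyc[of u v p] by simp
    have "ori v y u * ori t v p > 0"
      unfolding affine[of v y u t v p] using i tvy tvu
      by (auto simp: inside_def intro!: add_pos_pos mult_pos_pos)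
    moreover have "ori v y u * ori u z p > 0"
      unfolding affine[of v y u u z p] using i uzy o[OF zt(1)]
      by (auto simp: inside_def intro!: add_pos_pos mult_pos_pos)
    ultimately have "p \<in> Q" using p i vyu 1 by (simp add: Q_def inside_def zero_less_mult_iff)
    then have "ori v y u \<le> ori u v p" using y 1 by metis
    then show False using i bary[of v y p u] by (simp add: inside_def)
  qed
  have "ccw (u # ws @ [v, y])"
    using y xs(2,4) by (intro ccw_insert) (auto simp: Q_def z_def t_def)
  moreover from this have "void P (set (u # ws @ [v, y]))"
    using void_insert[OF P(1) xs(1) _ xs(3) e] by blast
  ultimately show ?thesis using y unfolding extendable_def by (auto simp: Q_def)
qed

text \<open>Whichever sign \<open>ori v u' u\<close> has, one of the two polygons is extendable.
  Non-extendability is a hypothesis, not derived from the absence of \<open>(k+1)\<close>-holes, so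
  that polygons with \<open>k - 1\<close> vertices are covered too.\<close>

lemma gap_determined:
  assumes P: "genpos P" "finite P"
    and xs: "set (u # ws @ [v]) \<subseteq> P" "ccw (u # ws @ [v])" "void P (set (u # ws @ [v]))" "ws \<noteq> []"
    and ys: "set (u' # ws' @ [v]) \<subseteq> P" "ccw (u' # ws' @ [v])" "void P (set (u' # ws' @ [v]))" "ws' \<noteq> []"
    and eq: "hd ws' = hd ws" "last ws' = last ws"
    and max: "\<not> extendable P (u # ws @ [v])" "\<not> extendable P (u' # ws' @ [v])"
  shows "u = u'"
proof (rule ccontr)
  assume ne: "u \<noteq> u'"
  have "ori u (hd ws) v > 0" "ori u' (hd ws') v > 0"
    using xs(2,4) ys(2,4) by (auto simp: sorted_wrt_append)
  then have "v \<noteq> u" "v \<noteq> u'" by auto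
  then have "ori v u' u \<noteq> 0" using P(1) xs(1) ys(1) ne unfolding genpos_def by auto
  then consider "ori v u' u > 0" | "ori v u u' > 0"
    using swap[of v u' u] cyc[of v u u'] cyc[of u' v u] by linarith
  then show False
    using extendable_gap[OF P xs ys eq] extendable_gap[OF P ys xs eq[symmetric]] max by cases blast+
qed

lemma list_ends:
  assumes "length L \<ge> 3"
  shows "\<exists>ws. L = L ! 0 # ws @ [L ! (length L - 1)] \<and> ws \<noteq> [] \<and> hd ws = L ! 1 \<and> last ws = L ! (length L - 2)"
proof -
  obtain a M where L: "L = a # M" using assms by (cases L) auto
  obtain ws b where M: "M = ws @ [b]" using assms L by (cases M rule: rev_cases) auto
  have "ws \<noteq> []" using assms L M by auto
  then show ?thesis using L M by (intro exI[of _ ws]) (auto simp: nth_append hd_conv_nth last_conv_nth nth_Cons split: nat.split)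
qed

text \<open>After rotating vertex \<open>j\<close> to the front, its two predecessors and its
  successor take the places of \<open>last ws\<close>, \<open>v\<close> and \<open>hd ws\<close>; an
  extension would be a \<open>(k+1)\<close>-hole.\<close>

lemma nth_determined:
  assumes P: "genpos P" "finite P" "k \<ge> 3" "hole_lists (Suc k) P = {}"
    and xs: "xs \<in> hole_lists k P" and ys: "ys \<in> hole_lists k P" and j: "j < k"
    and eq: "xs ! (Suc j mod k) = ys ! (Suc j mod k)" "xs ! ((j + k - 1) mod k) = ys ! ((j + k - 1) mod k)"
      "xs ! ((j + k - 2) mod k) = ys ! ((j + k - 2) mod k)"
  shows "xs ! j = ys ! j"
proof -
  have *: "\<exists>ws. rotate j zs = zs ! j # ws @ [zs ! ((j + k - 1) mod k)] \<and> ws \<noteq> [] \<and>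
      hd ws = zs ! (Suc j mod k) \<and> last ws = zs ! ((j + k - 2) mod k)" if "zs \<in> hole_lists k P" for zs
    using list_ends[of "rotate j zs"] that P(3) j by (auto simp: hole_lists_def nth_rotate)
  have **: "set (rotate j zs) \<subseteq> P \<and> ccw (rotate j zs) \<and> void P (set (rotate j zs)) \<and> \<not> extendable P (rotate j zs)"
    if "zs \<in> hole_lists k P" for zs
  proof -
    have "\<not> extendable P (rotate j zs)"
    proof
      assume "extendable P (rotate j zs)"
      then obtain y where "y \<in> P" "ccw (rotate j zs @ [y])" "void P (set (rotate j zs @ [y]))"
        unfolding extendable_def by blast
      then have "rotate j zs @ [y] \<in> hole_lists (Suc k) P"
        using that by (auto simp: hole_lists_def)
      then show False using P(4) by simp
    qed
    then show ?thesis using that by (auto simp: hole_lists_def ccw_rotate)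
  qed
  obtain ws ws' where "rotate j xs = xs ! j # ws @ [xs ! ((j + k - 1) mod k)]" "ws \<noteq> []"
    "hd ws = xs ! (Suc j mod k)" "last ws = xs ! ((j + k - 2) mod k)"
    "rotate j ys = ys ! j # ws' @ [xs ! ((j + k - 1) mod k)]" "ws' \<noteq> []"
    "hd ws' = hd ws" "last ws' = last ws" using *[OF xs] *[OF ys] eq by metis
  then show ?thesis using gap_determined[OF P(1,2)] **[OF xs] **[OF ys] by metis
qed

section \<open>Reconstructing a hole from half of its vertices\<close>

text \<open>The odd vertices are recovered in increasing order. The start works because
  \<open>2 * m\<close> and \<open>0\<close> are cyclic neighbours, so both predecessors of vertex 1
  are known.\<close>

lemma odd_positions_determine:
  assumes P: "genpos P" "finite P" "k = 2 * m + 1" "m \<ge> 1" "hole_lists (Suc k) P = {}"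
    and xs: "xs \<in> hole_lists k P" and ys: "ys \<in> hole_lists k P"
    and eq: "\<And>i. i \<le> m \<Longrightarrow> xs ! (2 * i) = ys ! (2 * i)"
  shows "xs = ys"
proof (rule nth_equalityI)
  show "length xs = length ys" using xs ys by (simp add: hole_lists_def)
  fix j assume "j < length xs"
  then have "j < k" using xs by (simp add: hole_lists_def)
  then show "xs ! j = ys ! j"
  proof (induction j rule: less_induct)
    case (less j)
    show ?case
    proof (cases "even j")
      case True
      then show ?thesis using eq[of "j div 2"] less.prems P(3) by auto
    next
      case False
      then obtain i where j: "j = 2 * i + 1" by (elim oddE)
      have i: "i < m" using j less.prems P(3) by simp
      have "xs ! ((j + k - 2) mod k) = ys ! ((j + k - 2) mod k)"
      proof (cases "i = 0")
        case True
        then have "(j + k - 2) mod k = 2 * m" using j P(3) by simp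
        then show ?thesis using eq[of m] by simp
      next
        case False
        then have "(j + k - 2) mod k = j - 2" using mod_add_diff_self[of 2 j k] less.prems j by simp
        then show ?thesis using less.IH[of "j - 2"] less.prems j False by simp
      qed
      moreover have "Suc j mod k = 2 * (i + 1)" using i j P(3) by simp
      moreover have "(j + k - 1) mod k = 2 * i" using mod_add_diff_self[of 1 j k] less.prems j by simp
      ultimately show ?thesis
        using nth_determined[OF P(1,2) _ P(5) xs ys less.prems] eq[of i] eq[of "i + 1"] i P(3,4) by simp
    qed
  qed
qed

text \<open>Deleting \<open>x\<close> and moving \<open>u\<close> to the front turns the gap before
  \<open>u\<close> into the closing gap, the one that \<open>extendable\<close> concerns.\<close>

lemma hole_list_rotate_prefix:
  assumes "B @ [u, x] \<in> hole_lists k P"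
  shows "set (u # B) \<subseteq> P" "ccw (u # B)" "void P (set (u # B))"
proof -
  have "ccw ((B @ [u]) @ [x])" using assms by (simp add: hole_lists_def)
  then have "ccw (B @ [u])" unfolding ccw_snoc by blast
  then show "ccw (u # B)" using ccw_rotate1 by blast
  show "set (u # B) \<subseteq> P" "void P (set (u # B))"
    using assms void_mono[of P "set (B @ [u, x])" "set (u # B)"] by (auto simp: hole_lists_def)
qed

text \<open>Positions 0 and 1 are the known pair of neighbours, from which all of \<open>B\<close>
  is recovered as in the odd case. Then \<open>u\<close> follows, and finally
  \<open>x\<close>.\<close>

lemma even_positions_determine:
  assumes P: "genpos P" "finite P" "k = 2 * m" "m \<ge> 3" "hole_lists (Suc k) P = {}"
    and xs: "B @ [u, x] \<in> hole_lists k P" and ys: "B' @ [u', x'] \<in> hole_lists k P"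
    and max: "\<not> extendable P (u # B)" "\<not> extendable P (u' # B')"
    and eq: "B ! 0 = B' ! 0" "\<And>i. i < m - 1 \<Longrightarrow> B ! (2 * i + 1) = B' ! (2 * i + 1)"
  shows "B @ [u, x] = B' @ [u', x']"
proof -
  let ?xs = "B @ [u, x]" and ?ys = "B' @ [u', x']"
  have len: "length B = 2 * m - 2" "length B' = 2 * m - 2" using xs ys P(3) by (auto simp: hole_lists_def)
  have nB: "?xs ! j = B ! j" "?ys ! j = B' ! j" if "j < 2 * m - 2" for j
    using that len by (simp_all add: nth_append)
  have "?xs ! j = ?ys ! j" if "j < 2 * m - 2" for j
    using that
  proof (induction j rule: less_induct)
    case (less j)
    show ?case
    proof (cases "j = 0 \<or> odd j")
      case True
      then show ?thesis
      proof
        assume "odd j"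
        then obtain i where "j = 2 * i + 1" by (elim oddE)
        then show ?thesis using eq(2)[of i] less.prems nB by simp
      qed (use eq(1) nB less.prems in simp)
    next
      case False
      then obtain c where "j = 2 * c" "c \<noteq> 0" by (metis dvdE mult_zero_right)
      then obtain i where j: "j = 2 * i + 2" by (cases c) auto
      have im: "i + 2 < m" using j less.prems by simp
      have "(j + k - 2) mod k = j - 2"
        using mod_add_diff_self[of 2 j k] less.prems j P(3) by simp
      then have "?xs ! ((j + k - 2) mod k) = ?ys ! ((j + k - 2) mod k)"
        using less.IH[of "j - 2"] less.prems j by simp
      moreover have "Suc j mod k = 2 * (i + 1) + 1" using im j P(3) by simp
      moreover have "(j + k - 1) mod k = 2 * i + 1"
        using mod_add_diff_self[of 1 j k] less.prems j P(3) by simp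
      moreover have "?xs ! (2 * i + 1) = ?ys ! (2 * i + 1)" "?xs ! (2 * (i + 1) + 1) = ?ys ! (2 * (i + 1) + 1)"
        using eq(2)[of i] eq(2)[of "i + 1"] im nB by simp_all
      ultimately show ?thesis
        using nth_determined[OF P(1,2) _ P(5) xs ys, of j] less.prems P(3,4) by simp
    qed
  qed
  then have "B ! j = B' ! j" if "j < length B" for j using that nB len by metis
  then have B: "B = B'" using len by (auto intro: nth_equalityI)
  define ws v where "ws = butlast B" and "v = last B"
  have "B \<noteq> []" using len P(4) by auto
  then have Bw: "B = ws @ [v]" by (simp add: ws_def v_def)
  then have "ws \<noteq> []" using len P(4) by auto
  have B'w: "B' = ws @ [v]" using B Bw by simp
  \<comment> \<open>As \<open>x\<close> is still unknown, \<open>u\<close> is compared in the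
    polygon without \<open>x\<close>, where \<open>B ! 0\<close> comes next after \<open>u\<close>.
    That polygon has \<open>k - 1\<close> vertices, so its maximality has to come from
    \<open>max\<close>.\<close>
  have u: "u = u'"
    using gap_determined[OF P(1,2) hole_list_rotate_prefix[OF xs, unfolded Bw] \<open>ws \<noteq> []\<close>
      hole_list_rotate_prefix[OF ys, unfolded B'w] \<open>ws \<noteq> []\<close>] max unfolding Bw B'w by simp
  have "?xs ! (2 * m - 1) = ?ys ! (2 * m - 1)"
  proof (rule nth_determined[OF P(1,2) _ P(5) xs ys])
    have *: "?xs ! j = ?ys ! j" if "j < 2 * m - 1" for j
      using that B u len by (auto simp: nth_append)
    have "(2 * m - 1 + k - 1) mod k = 2 * m - 2" "(2 * m - 1 + k - 2) mod k = 2 * m - 3"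
      "Suc (2 * m - 1) mod k = 0"
      using mod_add_diff_self[of 1 "2 * m - 1" k] mod_add_diff_self[of 2 "2 * m - 1" k] P(3,4) by simp_all
    then show "?xs ! (Suc (2 * m - 1) mod k) = ?ys ! (Suc (2 * m - 1) mod k)"
      "?xs ! ((2 * m - 1 + k - 1) mod k) = ?ys ! ((2 * m - 1 + k - 1) mod k)"
      "?xs ! ((2 * m - 1 + k - 2) mod k) = ?ys ! ((2 * m - 1 + k - 2) mod k)"
      using * P(4) by auto
  qed (use P in auto)
  moreover have "2 * m - 1 = length B' + 1" using len P(4) by simp
  ultimately show ?thesis using B u by (simp add: nth_append)
qed

text \<open>Delete \<open>x\<close>, insert a vertex \<open>a\<close> between \<open>last B\<close>
  and \<open>u\<close>, and \<open>b\<close> between \<open>y0\<close> and \<open>hd B\<close>: a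
  net gain of one. With \<open>length B \<ge> 2\<close>, the two edges next to the one cut by
  \<open>a\<close> survive the insertion of \<open>b\<close>, so the insertions do not
  interfere.\<close>

lemma two_sided_extension:
  assumes P: "genpos P" and xs: "y0 # B @ [u, x] \<in> hole_lists k P" "length B \<ge> 2"
    and a: "extendable P (u # y0 # B)"
    and b: "b \<in> P" "ccw (B @ [u, y0, b])" "void P (set (B @ [u, y0, b]))"
  shows "hole_lists (Suc k) P \<noteq> {}"
proof -
  obtain a where a: "a \<in> P" "ccw (u # y0 # B @ [a])" "void P (set (u # y0 # B @ [a]))"
    using a unfolding extendable_def by auto
  obtain C v where B: "B = C @ [v]" using xs(2) by (cases B rule: rev_cases) auto
  have C: "C \<noteq> []" using xs(2) B by auto
  have set: "set (u # (y0 # b # C) @ [v]) \<subseteq> P" using xs b B by (auto simp: hole_lists_def)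
  have c0: "ccw (u # (y0 # b # C) @ [v])"
    using b(2) ccw_append_commute[of B "[u, y0, b]"] B by simp
  moreover have "last C \<in> set C" using C by simp
  moreover have "ccw ((u # y0 # C @ [v]) @ [a])" using a(2) B by simp
  then have "sorted_wrt (\<lambda>x y. ori x y a > 0) (u # y0 # C @ [v])" unfolding ccw_snoc by blast
  ultimately have "ori v a u > 0" "ori (last C) v a > 0" "ori u y0 a > 0"
    using cyc[of u v a] by (simp_all add: sorted_wrt_append)
  with c0 have c: "ccw (u # (y0 # b # C) @ [v, a])"
    using C by (intro ccw_insert) auto
  have "void P (set (u # (y0 # b # C) @ [v]))"
    using b(3) B by (rule_tac void_mono) auto
  then have "void P (set (u # (y0 # b # C) @ [v, a]))"
    using a(3) B by (intro void_insert[OF P set c]) (auto simp: void_def)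
  then have "u # (y0 # b # C) @ [v, a] \<in> hole_lists (Suc k) P"
    using c set a(1) xs B by (auto simp: hole_lists_def)
  then show ?thesis by blast
qed

section \<open>Mirror images by negating the orientation\<close>

lemma orientation_neg: "orientation (\<lambda>a b c. - ori a b c)"
proof
  fix a b c p e f
  show "- ori a b c = - ori b c a" using cyc[of a b c] by simp
  show "- ori a b c = - (- ori b a c)" using swap[of a b c] by simp
  show "- ori a b p + - ori b c p + - ori c a p = - ori a b c" using bary[of a b p c] by simp
  show "- ori a b c * - ori e f p = - ori b c p * - ori e f a + - ori c a p * - ori e f b + - ori a b p * - ori e f c"
    using affine[of a b c e f p] by simp
qed

lemma inside_neg: "orientation.inside (\<lambda>a b c. - ori a b c) a b c p \<longleftrightarrow> inside b a c p"
proof -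
  interpret neg: orientation "\<lambda>a b c. - ori a b c" by (rule orientation_neg)
  show ?thesis using swap[of a b p] swap[of b c p] swap[of c a p]
    unfolding inside_def neg.inside_def by linarith
qed

lemma void_neg: "orientation.void (\<lambda>a b c. - ori a b c) P X \<longleftrightarrow> void P X"
proof -
  interpret neg: orientation "\<lambda>a b c. - ori a b c" by (rule orientation_neg)
  show ?thesis unfolding void_def neg.void_def inside_neg by blast
qed

lemma genpos_neg: "orientation.genpos (\<lambda>a b c. - ori a b c) P \<longleftrightarrow> genpos P"
proof -
  interpret neg: orientation "\<lambda>a b c. - ori a b c" by (rule orientation_neg)
  show ?thesis unfolding genpos_def neg.genpos_def by simp
qed

lemma ccw_neg: "orientation.ccw (\<lambda>a b c. - ori a b c) xs \<longleftrightarrow> ccw (rev xs)"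
proof -
  interpret neg: orientation "\<lambda>a b c. - ori a b c" by (rule orientation_neg)
  have "(\<lambda>b c. 0 < - ori x b c) = (\<lambda>b c. ori c b x > 0)" for x
  proof (intro ext)
    fix b c show "(0 < - ori x b c) = (ori c b x > 0)"
      using swap[of x b c] cyc[of b x c] cyc[of x c b] by linarith
  qed
  then show ?thesis by (induction xs) (simp_all add: ccw_snoc sorted_wrt_rev conj_commute)
qed

lemma hole_lists_neg: "xs \<in> orientation.hole_lists (\<lambda>a b c. - ori a b c) k P \<longleftrightarrow> rev xs \<in> hole_lists k P"
proof -
  interpret neg: orientation "\<lambda>a b c. - ori a b c" by (rule orientation_neg)
  show ?thesis by (simp add: hole_lists_def neg.hole_lists_def void_neg ccw_neg)
qed

section \<open>Counting holes by selected vertices\<close>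

text \<open>A list is encoded by the set of its selected vertices together with the first of them.
  By \<open>ccw_unique\<close> this pair restores the selected sublist, and each
  \<open>r\<close>-subset occurs in at most \<open>r\<close> pairs.\<close>

lemma card_le_determined:
  assumes "finite P" "F \<subseteq> hole_lists k P"
    and I: "sorted_wrt (<) I" "set I \<subseteq> {..<k}" "length I = r" "r \<ge> 3"
    and det: "\<And>xs ys. xs \<in> F \<Longrightarrow> ys \<in> F \<Longrightarrow> (\<And>i. i \<in> set I \<Longrightarrow> xs ! i = ys ! i) \<Longrightarrow> xs = ys"
  shows "card F \<le> r * (card P choose r)"
proof -
  let ?S = "\<lambda>xs. map ((!) xs) I"
  let ?A = "Sigma {S. S \<subseteq> P \<and> card S = r} (\<lambda>S. S)"
  have fin: "finite {S. S \<subseteq> P \<and> card S = r}" using assms(1) by simp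
  have S: "ccw (?S xs)" "distinct (?S xs)" "length (?S xs) = r" "set (?S xs) \<subseteq> P" if "xs \<in> F" for xs
  proof -
    have xs: "length xs = k" "set xs \<subseteq> P" "ccw xs" using that assms(2) by (auto simp: hole_lists_def)
    show "ccw (?S xs)" using xs I by (intro ccw_map_nth) auto
    then show "distinct (?S xs)" using I by (intro ccw_distinct) auto
    show "length (?S xs) = r" using I by simp
    show "set (?S xs) \<subseteq> P" using xs I(2) by (auto simp: subset_iff)
  qed
  have "inj_on (\<lambda>xs. (set (?S xs), hd (?S xs))) F"
  proof (rule inj_onI)
    fix xs ys assume F: "xs \<in> F" "ys \<in> F" and eq: "(set (?S xs), hd (?S xs)) = (set (?S ys), hd (?S ys))"
    obtain h A where A: "?S xs = h # A" using I by (cases "?S xs") auto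
    obtain h' B where B: "?S ys = h' # B" using I by (cases "?S ys") auto
    have "h = h'" "insert h (set A) = insert h (set B)"
      using eq unfolding A B by auto
    moreover have d: "distinct (h # A)" "distinct (h' # B)" using S(2) F A B by metis+
    ultimately have "set A = set B" by (auto simp: insert_ident)
    moreover have "ccw (h # A)" "ccw (h # B)" using S(1) F A B \<open>h = h'\<close> by metis+
    ultimately have "A = B" using d by (intro ccw_unique[of h]) auto
    then have "?S xs = ?S ys" using A B \<open>h = h'\<close> by simp
    then show "xs = ys" using det[OF F] by simp
  qed
  moreover have "(\<lambda>xs. (set (?S xs), hd (?S xs))) ` F \<subseteq> ?A"
  proof
    fix z assume "z \<in> (\<lambda>xs. (set (?S xs), hd (?S xs))) ` F"
    then obtain xs where xs: "xs \<in> F" and z: "z = (set (?S xs), hd (?S xs))" by blast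
    have "?S xs \<noteq> []" using I by auto
    then have "hd (?S xs) \<in> set (?S xs)" by (rule hd_in_set)
    moreover have "card (set (?S xs)) = r" using S(2,3)[OF xs] distinct_card by metis
    ultimately show "z \<in> ?A" using z S(4)[OF xs] by blast
  qed
  moreover have "finite ?A" using assms(1) fin by (intro finite_SigmaI) (auto intro: finite_subset)
  ultimately have "card F \<le> card ?A" by (rule card_inj_on_le)
  also have "card ?A = (\<Sum>S\<in>{S. S \<subseteq> P \<and> card S = r}. card S)"
    using assms(1) fin by (intro card_SigmaI) (auto intro: finite_subset)
  also have "\<dots> = r * (card P choose r)"
    using n_subsets[OF assms(1), of r] by simp
  finally show ?thesis .
qed

lemma sorted_wrt_less_map_upt: "(\<And>i j. i < j \<Longrightarrow> f i < f j) \<Longrightarrow> sorted_wrt (<) (map f [0..<n])" for f :: "nat \<Rightarrow> nat"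
  by (simp add: sorted_wrt_iff_nth_less)

lemma card_hole_lists_odd:
  assumes "genpos P" "finite P" "m \<ge> 2" "hole_lists (2 * m + 2) P = {}"
  shows "card (hole_lists (2 * m + 1) P) \<le> (m + 1) * (card P choose (m + 1))"
proof (rule card_le_determined[where I = "map (\<lambda>i. 2 * i) [0..<m + 1]"])
  show "sorted_wrt (<) (map (\<lambda>i. 2 * i) [0..<m + 1])" by (rule sorted_wrt_less_map_upt) simp
  show "set (map (\<lambda>i. 2 * i) [0..<m + 1]) \<subseteq> {..<2 * m + 1}" by auto
  fix xs ys assume "xs \<in> hole_lists (2 * m + 1) P" "ys \<in> hole_lists (2 * m + 1) P"
    and eq: "\<And>i. i \<in> set (map (\<lambda>i. 2 * i) [0..<m + 1]) \<Longrightarrow> xs ! i = ys ! i"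
  moreover have "xs ! (2 * i) = ys ! (2 * i)" if "i \<le> m" for i using that by (intro eq) auto
  ultimately show "xs = ys" using assms by (intro odd_positions_determine[of P "2 * m + 1" m xs ys]) auto
qed (use assms in auto)

text \<open>The list is \<open>[x\<^sub>3, x\<^sub>4, \<dots>, x\<^sub>0, x\<^sub>1, x\<^sub>2]\<close> in the notation of the introduction.\<close>

definition one_sided :: "nat \<Rightarrow> 'a set \<Rightarrow> 'a list set" where
  "one_sided k P = {xs \<in> hole_lists k P. \<not> extendable P (xs ! (k - 2) # take (k - 2) xs)}"

lemma split_last_two: "length xs = k \<Longrightarrow> k \<ge> 2 \<Longrightarrow> xs = take (k - 2) xs @ [xs ! (k - 2), xs ! (k - 1)]"
  using id_take_nth_drop[of "k - 2" xs] Cons_nth_drop_Suc[of "k - 1" xs] by (simp add: Suc_diff_Suc numeral_2_eq_2)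

text \<open>The \<open>m\<close> selected positions are 0 and the odd numbers up to
  \<open>2 * m - 3\<close>: a pair of neighbours, then every second vertex, and neither of the last
  two.\<close>

lemma card_one_sided:
  assumes "genpos P" "finite P" "m \<ge> 3" "hole_lists (2 * m + 1) P = {}"
  shows "card (one_sided (2 * m) P) \<le> m * (card P choose m)"
proof (rule card_le_determined[where I = "0 # map (\<lambda>i. 2 * i + 1) [0..<m - 1]"])
  let ?I = "0 # map (\<lambda>i. 2 * i + 1) [0..<m - 1]"
  show "sorted_wrt (<) ?I" using sorted_wrt_less_map_upt[of "\<lambda>i. 2 * i + 1" "m - 1"] by auto
  show "set ?I \<subseteq> {..<2 * m}" using assms by auto
  fix xs ys assume F: "xs \<in> one_sided (2 * m) P" "ys \<in> one_sided (2 * m) P"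
    and eq: "\<And>i. i \<in> set ?I \<Longrightarrow> xs ! i = ys ! i"
  define B B' where "B = take (2 * m - 2) xs" and "B' = take (2 * m - 2) ys"
  define u u' where "u = xs ! (2 * m - 2)" and "u' = ys ! (2 * m - 2)"
  define x x' where "x = xs ! (2 * m - 1)" and "x' = ys ! (2 * m - 1)"
  have len: "length xs = 2 * m" "length ys = 2 * m" using F by (auto simp: one_sided_def hole_lists_def)
  have xs: "xs = B @ [u, x]" "ys = B' @ [u', x']"
    using split_last_two[OF len(1)] split_last_two[OF len(2)] assms(3)
    by (simp_all add: B_def B'_def u_def u'_def x_def x'_def)
  have "B @ [u, x] = B' @ [u', x']"
  proof (rule even_positions_determine[of P "2 * m" m])
    show "\<not> extendable P (u # B)" "\<not> extendable P (u' # B')" 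
      using F by (simp_all add: one_sided_def B_def B'_def u_def u'_def)
    show "B @ [u, x] \<in> hole_lists (2 * m) P" "B' @ [u', x'] \<in> hole_lists (2 * m) P"
      using F xs by (simp_all add: one_sided_def)
    show "B ! 0 = B' ! 0" using eq[of 0] assms(3) by (simp add: B_def B'_def)
    fix i assume "i < m - 1"
    then show "B ! (2 * i + 1) = B' ! (2 * i + 1)" using eq[of "2 * i + 1"] by (simp add: B_def B'_def)
  qed (use assms in auto)
  then show "xs = ys" using xs by simp
qed (use assms in \<open>auto simp: one_sided_def\<close>)

text \<open>In the mirror image the order is reversed: \<open>x\<^sub>1\<close> and
  \<open>x\<^sub>3\<close> exchange roles, and \<open>x\<^sub>2\<close> stays last.\<close>

definition reflect :: "'a list \<Rightarrow> 'a list" where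
  "reflect xs = rev (butlast (tl xs)) @ [hd xs, last xs]"

lemma reflect_simp: "reflect (y # B @ [u, x]) = u # rev B @ [y, x]"
  by (simp add: reflect_def butlast_append)

text \<open>A list outside \<open>one_sided\<close> admits an insertion before \<open>u\<close>. By
  \<open>two_sided_extension\<close> none is then possible on the other side, so its reflection is
  one-sided for the negated orientation. Both classes obey the bound of
  \<open>card_one_sided\<close>.\<close>

lemma card_hole_lists_even:
  assumes P: "genpos P" "finite P" "m \<ge> 3" "hole_lists (2 * m + 1) P = {}"
  shows "card (hole_lists (2 * m) P) \<le> 2 * (m * (card P choose m))"
proof -
  interpret neg: orientation "\<lambda>a b c. - ori a b c" by (rule orientation_neg)
  let ?H = "hole_lists (2 * m) P" and ?O = "one_sided (2 * m) P"
  have form: "\<exists>y B u x. xs = y # B @ [u, x] \<and> length B = 2 * m - 3" if "xs \<in> ?H" for xs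
  proof -
    have len: "length xs = 2 * m" using that by (simp add: hole_lists_def)
    obtain C u x where C: "xs = C @ [u, x]" "length C = 2 * m - 2"
      using split_last_two[OF len] P(3) len by fastforce
    then obtain y B where "C = y # B" using P(3) by (cases C) auto
    then show ?thesis using C by auto
  qed
  have "reflect xs \<in> neg.one_sided (2 * m) P" if xs: "xs \<in> ?H - ?O" for xs
  proof -
    obtain y B u x where f: "xs = y # B @ [u, x]" "length B = 2 * m - 3" using form xs by blast
    have k: "2 * m - 2 = length (y # B)" using f P(3) by simp
    have ext: "extendable P (u # y # B)"
      using xs f k by (auto simp: one_sided_def nth_append)
    have H: "y # B @ [u, x] \<in> ?H" using xs f by simp
    have "rev (reflect xs) = [x, y] @ (B @ [u])" using f by (simp add: reflect_simp)
    moreover have "ccw ((y # B @ [u]) @ [x])" using H by (simp add: hole_lists_def)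
    then have "ccw ([x] @ (y # B @ [u]))" using ccw_append_commute by blast
    ultimately have "rev (reflect xs) \<in> ?H" using H by (auto simp: hole_lists_def insert_commute)
    then have r: "reflect xs \<in> neg.hole_lists (2 * m) P" by (simp add: hole_lists_neg)
    have "\<not> neg.extendable P (y # u # rev B)"
    proof
      assume "neg.extendable P (y # u # rev B)"
      then obtain b where b: "b \<in> P" "neg.ccw ((y # u # rev B) @ [b])" "neg.void P (set ((y # u # rev B) @ [b]))"
        unfolding neg.extendable_def by blast
      then have "ccw ([b] @ (B @ [u, y]))" by (simp add: ccw_neg)
      then have "ccw (B @ [u, y, b])" using ccw_append_commute[of "[b]" "B @ [u, y]"] by simp
      moreover have "void P (set (B @ [u, y, b]))"
        using b(3) unfolding void_neg by (rule void_mono) auto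
      ultimately have "hole_lists (Suc (2 * m)) P \<noteq> {}"
        using two_sided_extension[OF P(1) H _ ext b(1)] f P(3) by simp
      then show False using P(4) by simp
    qed
    moreover have "reflect xs ! (2 * m - 2) = y" "take (2 * m - 2) (reflect xs) = u # rev B"
      using f k by (simp_all add: reflect_simp nth_append)
    ultimately show ?thesis using r by (simp add: neg.one_sided_def)
  qed
  then have "reflect ` (?H - ?O) \<subseteq> neg.one_sided (2 * m) P" by blast
  moreover have "finite (neg.one_sided (2 * m) P)"
    using neg.finite_hole_lists[OF P(2), of "2 * m"] by (simp add: neg.one_sided_def)
  moreover have "inj_on reflect (?H - ?O)"
  proof (rule inj_onI)
    fix xs ys assume *: "xs \<in> ?H - ?O" "ys \<in> ?H - ?O" "reflect xs = reflect ys"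
    then obtain y B u x y' B' u' x' where "xs = y # B @ [u, x]" "ys = y' # B' @ [u', x']" using form by (metis Diff_iff)
    then show "xs = ys" using *(3) by (auto simp: reflect_simp)
  qed
  ultimately have "card (?H - ?O) \<le> card (neg.one_sided (2 * m) P)" using card_inj_on_le by blast
  also have "\<dots> \<le> m * (card P choose m)"
  proof (rule neg.card_one_sided[OF _ P(2,3)])
    show "neg.genpos P" using P(1) by (simp add: genpos_neg)
    show "neg.hole_lists (2 * m + 1) P = {}" using P(4) hole_lists_neg by blast
  qed
  finally have 1: "card (?H - ?O) \<le> m * (card P choose m)" .
  have "?H = ?O \<union> (?H - ?O)" by (auto simp: one_sided_def)
  then have "card ?H \<le> card ?O + card (?H - ?O)" by (metis card_Un_le)
  then show ?thesis using 1 card_one_sided[OF P] by simp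
qed

end

section \<open>Holes in the plane\<close>

text \<open>Twice the signed area of the triangle \<open>a, b, c\<close>, positive in
  counterclockwise order.\<close>

definition det3 :: "real^2 \<Rightarrow> real^2 \<Rightarrow> real^2 \<Rightarrow> real" where
  "det3 a b c = (b$1 - a$1) * (c$2 - a$2) - (b$2 - a$2) * (c$1 - a$1)"

interpretation plane: orientation det3
proof
  fix a b c p e f :: "real^2"
  show "det3 a b c * det3 e f p = det3 b c p * det3 e f a + det3 c a p * det3 e f b + det3 a b p * det3 e f c"
    unfolding det3_def by algebra
qed (simp_all add: det3_def algebra_simps)

lemma collinear_iff_det3: "collinear {a, b, c} \<longleftrightarrow> det3 a b c = 0"
proof
  assume "collinear {a, b, c}"
  then obtain u where u: "\<forall>x\<in>{a, b, c}. \<forall>y\<in>{a, b, c}. \<exists>k. x - y = k *\<^sub>R u" unfolding collinear_def by blast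
  then obtain k l where "b - a = k *\<^sub>R u" "c - a = l *\<^sub>R u" by blast
  then have "b$i - a$i = k * u$i" "c$i - a$i = l * u$i" for i
    by (metis vector_minus_component vector_scaleR_component real_scaleR_def)+
  then show "det3 a b c = 0" by (simp add: det3_def)
next
  assume d: "det3 a b c = 0"
  show "collinear {a, b, c}"
  proof (cases "a = b")
    case False
    then have "a$1 \<noteq> b$1 \<or> a$2 \<noteq> b$2" by (auto simp: vec_eq_iff forall_2)
    then have "\<exists>k. c - b = k *\<^sub>R (a - b)"
    proof
      assume *: "a$1 \<noteq> b$1"
      then have "(c$1 - b$1) / (a$1 - b$1) * (a$2 - b$2) = c$2 - b$2"
        using d by (simp add: det3_def field_simps)
      then have "c - b = ((c$1 - b$1) / (a$1 - b$1)) *\<^sub>R (a - b)"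
        using * by (simp add: vec_eq_iff forall_2)
      then show ?thesis by blast
    next
      assume *: "a$2 \<noteq> b$2"
      then have "(c$2 - b$2) / (a$2 - b$2) * (a$1 - b$1) = c$1 - b$1"
        using d by (simp add: det3_def field_simps)
      then have "c - b = ((c$2 - b$2) / (a$2 - b$2)) *\<^sub>R (a - b)"
        using * by (simp add: vec_eq_iff forall_2)
      then show ?thesis by blast
    qed
    then show ?thesis
      by (subst collinear_3) (auto simp: collinear_lemma)
  qed simp
qed

lemma general_position_iff: "general_position P \<longleftrightarrow> plane.genpos P"
proof
  assume g: "general_position P"
  show "plane.genpos P" unfolding plane.genpos_def
  proof (intro ballI impI, rule ccontr)
    fix a b c assume *: "a \<in> P" "b \<in> P" "c \<in> P" "det3 a b c = 0" "\<not> (a = b \<or> b = c \<or> a = c)"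
    then have "card {a, b, c} = 3" "{a, b, c} \<subseteq> P" by auto
    then show False using g *(4) collinear_iff_det3 unfolding general_position_def by blast
  qed
next
  assume g: "plane.genpos P"
  show "general_position P" unfolding general_position_def
  proof (intro allI impI)
    fix T assume "T \<subseteq> P" "card T = 3"
    then obtain a b c where "T = {a, b, c}" "a \<noteq> b" "b \<noteq> c" "a \<noteq> c" "a \<in> P" "b \<in> P" "c \<in> P"
      by (auto simp: card_3_iff)
    then show "\<not> collinear T" using g collinear_iff_det3 unfolding plane.genpos_def by blast
  qed
qed

text \<open>The three determinants, divided by \<open>det3 a b c\<close>, are the barycentric
  coordinates of \<open>p\<close>.\<close>

lemma inside_subset_convex_hull: "plane.inside a b c p \<Longrightarrow> p \<in> convex hull {a, b, c}"
proof -
  assume i: "plane.inside a b c p"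
  then have d: "det3 a b c > 0" by (rule plane.inside_ori)
  let ?u = "det3 b c p / det3 a b c" and ?v = "det3 c a p / det3 a b c" and ?w = "det3 a b p / det3 a b c"
  have "det3 a b c * p$j = det3 b c p * a$j + det3 c a p * b$j + det3 a b p * c$j" if "j = 1 \<or> j = 2" for j
    using that by (auto simp: det3_def algebra_simps)
  then have "p$j = ?u * a$j + ?v * b$j + ?w * c$j" if "j = 1 \<or> j = 2" for j
    using d that by (simp add: field_simps)
  then have "p = ?u *\<^sub>R a + ?v *\<^sub>R b + ?w *\<^sub>R c"
    by (simp add: vec_eq_iff forall_2)
  moreover have "?u + ?v + ?w = 1"
    using d plane.bary[of a b p c] by (simp add: add_divide_distrib[symmetric])
  ultimately show ?thesis using i d unfolding convex_hull_3 plane.inside_def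
    by (intro CollectI exI[of _ ?u] exI[of _ ?v] exI[of _ ?w]) auto
qed

lemma inside_interior:
  assumes "plane.inside a b c p" shows "p \<in> interior (convex hull {a, b, c})"
proof -
  have "open {p. plane.inside a b c p}"
    unfolding plane.inside_def det3_def
    by (intro open_Collect_conj open_Collect_less continuous_intros)
  moreover have "{p. plane.inside a b c p} \<subseteq> convex hull {a, b, c}"
    using inside_subset_convex_hull by blast
  ultimately show ?thesis using assms interior_maximal by blast
qed

lemma convex_hull_3_cases:
  assumes P: "plane.genpos P" "a \<in> P" "b \<in> P" "c \<in> P" "p \<in> P" and p: "p \<in> convex hull {a, b, c}"
  shows "p \<in> {a, b, c} \<or> plane.inside a b c p \<or> plane.inside b a c p"
proof (rule ccontr)
  assume not: "\<not> ?thesis"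
  obtain u v w where uvw: "u \<ge> 0" "v \<ge> 0" "w \<ge> 0" "u + v + w = 1"
    and p: "p = u *\<^sub>R a + v *\<^sub>R b + w *\<^sub>R c" using p unfolding convex_hull_3 by auto
  have u: "u = 1 - v - w" using uvw by simp
  have d: "det3 a b p = w * det3 a b c" "det3 b c p = u * det3 a b c" "det3 c a p = v * det3 a b c"
    unfolding det3_def p u by (simp_all, algebra+)
  have s: "det3 b a p = - det3 a b p" "det3 a c p = - det3 c a p" "det3 c b p = - det3 b c p"
    by (rule plane.swap)+
  have g: "x = y \<or> y = p \<or> x = p" if "det3 x y p = 0" "x \<in> P" "y \<in> P" for x y
    using P that unfolding plane.genpos_def by blast
  show False
  proof (cases "det3 a b c = 0")
    case True
    then have "det3 a b p = 0" "det3 b c p = 0" using d by auto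
    then have "a = b" "b = c" using g P not by blast+
    then have "p = a" using p u by (simp add: algebra_simps)
    then show False using not by simp
  next
    case False
    have "w \<noteq> 0" "u \<noteq> 0" "v \<noteq> 0"
    proof -
      have "a \<noteq> b" "b \<noteq> c" "c \<noteq> a" using False by auto
      then have "det3 a b p \<noteq> 0" "det3 b c p \<noteq> 0" "det3 c a p \<noteq> 0" using g P not by blast+
      then show "w \<noteq> 0" "u \<noteq> 0" "v \<noteq> 0" using d by auto
    qed
    then have pos: "w > 0" "u > 0" "v > 0" using uvw by auto
    show False
    proof (cases "det3 a b c > 0")
      case True
      then have "plane.inside a b c p" unfolding plane.inside_def d using pos by simp
      then show False using not by simp
    next
      case neg: False
      then have "det3 a b c < 0" using False by simp
      then have "plane.inside b a c p"
        unfolding plane.inside_def s d using pos by (simp add: mult_pos_neg)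
      then show False using not by simp
    qed
  qed
qed

text \<open>By Caratheodory's theorem \<open>p\<close> is in the hull of at most three points of
  \<open>X\<close>; in general position it is one of them or strictly inside their triangle, and
  voidness excludes the latter.\<close>

lemma void_convex_hull:
  assumes P: "plane.genpos P" "plane.void P X" "X \<subseteq> P" "p \<in> P" and p: "p \<in> convex hull X"
  shows "p \<in> X"
proof -
  obtain S where S: "finite S" "S \<subseteq> X" "card S \<le> 3" "p \<in> convex hull S"
    using p unfolding caratheodory[of X] by auto
  then have "S \<noteq> {}" by auto
  then have "card S = 1 \<or> card S = 2 \<or> card S = 3" using S by (metis One_nat_def Suc_1 card_0_eq le_SucE le_zero_eq numeral_3_eq_3)
  then obtain a b c where "S = {a, b, c}"
    using card_1_singletonE[of S] card_2_iff[of S] card_3_iff[of S] by (metis insert_absorb2)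
  then have "a \<in> X" "b \<in> X" "c \<in> X" "p \<in> convex hull {a, b, c}" using S by auto
  then show ?thesis
    using convex_hull_3_cases[OF P(1) _ _ _ P(4)] P(2,3,4) unfolding plane.void_def by blast
qed

text \<open>This links the geometric notion to the abstract one. If \<open>X\<close> is void,
  \<open>void_convex_hull\<close> keeps each point out of the hull of the others, so all are
  extreme, and three non-collinear ones give dimension 2. Conversely, a point inside a triangle is
  interior to the hull.\<close>

lemma hole_iff_void:
  assumes P: "plane.genpos P" and X: "X \<subseteq> P" "card X = k" and k: "k \<ge> 3"
  shows "X \<in> holes k P \<longleftrightarrow> plane.void P X"
proof
  assume "X \<in> holes k P"
  then have i: "interior (convex hull X) \<inter> P = {}" by (simp add: holes_def)
  show "plane.void P X" unfolding plane.void_def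
  proof (intro ballI notI)
    fix a b c p assume *: "a \<in> X" "b \<in> X" "c \<in> X" "p \<in> P" "plane.inside a b c p"
    then have "p \<in> interior (convex hull {a, b, c})" by (intro inside_interior)
    moreover have "interior (convex hull {a, b, c}) \<subseteq> interior (convex hull X)"
      using * by (intro interior_mono hull_mono) auto
    ultimately show False using i *(4) by blast
  qed
next
  assume v: "plane.void P X"
  have fin: "finite X" using X k by (intro card_ge_0_finite) simp
  have "x \<notin> convex hull (X - {x})" if "x \<in> X" for x
  proof
    assume "x \<in> convex hull (X - {x})"
    moreover have "plane.void P (X - {x})" using v by (rule plane.void_mono) blast
    ultimately have "x \<in> X - {x}" using void_convex_hull[OF P, of "X - {x}" x] that X(1) by blast
    then show False by simp
  qed
  then have ext: "x extreme_point_of (convex hull X) \<longleftrightarrow> x \<in> X" for x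
    by (rule extreme_point_of_convex_hull_convex_independent[OF finite_imp_compact[OF fin]])
  obtain T where T: "T \<subseteq> X" "card T = 3" using obtain_subset_with_card_n[of 3 X] k X(2) by metis
  then obtain a b c where "T = {a, b, c}" "a \<noteq> b" "b \<noteq> c" "a \<noteq> c" by (auto simp: card_3_iff)
  moreover from this have abc: "{a, b, c} \<subseteq> X" "a \<in> P" "b \<in> P" "c \<in> P" using T X(1) by auto
  ultimately have "det3 a b c \<noteq> 0" using P unfolding plane.genpos_def by metis
  then have "\<not> collinear X" using collinear_iff_det3[of a b c] collinear_subset[of X "{a, b, c}"] abc(1) by metis
  then have "aff_dim X \<ge> 2" by (simp add: collinear_aff_dim)
  moreover have "aff_dim X \<le> 2" using aff_dim_le_DIM[of X] by simp
  ultimately have "aff_dim (convex hull X) = 2" by (simp add: aff_dim_convex_hull)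
  then have "convex_position X" unfolding convex_position_def
    using fin ext polytope_convex_hull[OF fin] by blast
  moreover have "interior (convex hull X) \<inter> P = {}"
  proof (intro equals0I)
    fix p assume p: "p \<in> interior (convex hull X) \<inter> P"
    then have "p \<in> convex hull X" using interior_subset[of "convex hull X"] by blast
    then have "p \<in> X" using void_convex_hull[OF P v X(1)] p by blast
    then show False using ext[of p] extreme_point_not_in_interior[of p "convex hull X"] p by blast
  qed
  ultimately show "X \<in> holes k P" using X by (simp add: holes_def)
qed

lemma holes_eq_void:
  assumes "plane.genpos P" "k \<ge> 3"
  shows "holes k P = {X. X \<subseteq> P \<and> card X = k \<and> plane.void P X}"
  using hole_iff_void[OF assms(1)] assms(2) by (auto simp: holes_def)

lemma card_holes_le:
  assumes P: "finite P" "general_position P" and k: "k \<ge> 5" and no: "holes (k + 1) P = {}"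
  shows "card (holes k P) \<le> 2 * (((k + 1) div 2) * (card P choose ((k + 1) div 2)))"
proof -
  have g: "plane.genpos P" using P general_position_iff by blast
  have no': "plane.hole_lists (k + 1) P = {}"
  proof (rule equals0I)
    fix xs assume "xs \<in> plane.hole_lists (k + 1) P"
    then have xs: "length xs = k + 1" "set xs \<subseteq> P" "plane.ccw xs" "plane.void P (set xs)"
      by (auto simp: plane.hole_lists_def)
    then have "card (set xs) = k + 1" using plane.ccw_distinct[of xs] k distinct_card by fastforce
    then have "set xs \<in> holes (k + 1) P" using hole_iff_void[OF g xs(2)] xs k by simp
    then show False using no by simp
  qed
  have "card (holes k P) \<le> card (plane.hole_lists k P)"
    using plane.card_void_subsets_le[OF P(1) g] holes_eq_void[OF g] k by simp
  also have "\<dots> \<le> 2 * (((k + 1) div 2) * (card P choose ((k + 1) div 2)))"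
  proof (cases "even k")
    case True
    then obtain m where m: "k = 2 * m" by (elim evenE)
    then show ?thesis using plane.card_hole_lists_even[OF g P(1), of m] no' k by simp
  next
    case False
    then obtain m where m: "k = 2 * m + 1" by (elim oddE)
    have "card (plane.hole_lists (2 * m + 1) P) \<le> (m + 1) * (card P choose (m + 1))"
      using plane.card_hole_lists_odd[OF g P(1), of m] no' k m by simp
    moreover have "(k + 1) div 2 = m + 1" using m by simp
    ultimately show ?thesis using m by simp
  qed
  finally show ?thesis .
qed

section \<open>Arithmetic of the upper bound\<close>

text \<open>The induction step rests on \<open>(1 + 1 / n) ^ n \<le> exp 1 \<le> 3\<close>.\<close>

lemma power_le_exp_fact: "real n ^ n \<le> 3 ^ n * fact n"
proof (induction n)
  case (Suc n)
  show ?case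
  proof (cases "n = 0")
    case False
    have "(1 + 1 / real n) ^ n \<le> exp 1"
      using exp_ge_one_plus_x_over_n_power_n[of n 1] False by simp
    also have "\<dots> \<le> 3" using exp_le by simp
    finally have "(1 + 1 / real n) ^ n \<le> 3" .
    have "(1 + 1 / real n) * real n = real (Suc n)"
      using False by (simp add: field_simps)
    then have "real (Suc n) ^ Suc n = real (Suc n) * ((1 + 1 / real n) * real n) ^ n" by simp
    also have "\<dots> = real (Suc n) * ((1 + 1 / real n) ^ n * real n ^ n)"
      by (simp add: power_mult_distrib)
    also have "\<dots> \<le> real (Suc n) * (3 * (3 ^ n * fact n))"
      using \<open>(1 + 1 / real n) ^ n \<le> 3\<close> Suc by (intro mult_left_mono mult_mono) auto
    finally show ?thesis by (simp add: algebra_simps)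
  qed simp
qed simp

text \<open>The constant is \<open>12 = 2 * 2 * 3\<close>, from \<open>2 * r \<le> 2 ^ r\<close>,
  \<open>k \<le> 2 * r\<close> and \<open>r ^ r \<le> 3 ^ r * fact r\<close>.\<close>

lemma upper_bound_arith:
  assumes "k \<ge> 5" "p \<le> n" and r: "r = (k + 1) div 2"
  shows "real (2 * (r * (p choose r))) \<le> (12 / real k) ^ r * real n ^ r"
proof -
  have r0: "r \<ge> 3" and kr: "real k \<le> 2 * real r" using assms by auto
  have two: "2 * r \<le> 2 ^ r" using r0
  proof (induction r rule: dec_induct)
    case (step i)
    have "(2::nat) \<le> 2 ^ i" using step(1) by (cases i) auto
    then show ?case using step by simp
  qed simp
  have "real ((p choose r) * fact r) \<le> real (p ^ r)" using binomial_fact_pow by (simp only: of_nat_le_iff)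
  also have "\<dots> \<le> real n ^ r" using assms(2) by (simp add: power_mono)
  finally have c: "real (p choose r) * fact r \<le> real n ^ r" by simp
  have "real (p choose r) * real r ^ r \<le> real (p choose r) * (3 ^ r * fact r)"
    using power_le_exp_fact by (intro mult_left_mono) auto
  also have "\<dots> \<le> 3 ^ r * real n ^ r" using c by simp
  finally have c: "real (p choose r) * real r ^ r \<le> 3 ^ r * real n ^ r" .
  have "real (2 * (r * (p choose r))) * real k ^ r = real (2 * r) * (real (p choose r) * real k ^ r)" by simp
  also have "\<dots> \<le> 2 ^ r * (real (p choose r) * (2 * real r) ^ r)"
    using two kr by (intro mult_mono mult_left_mono power_mono) (auto simp del: of_nat_mult simp flip: of_nat_power)
  also have "\<dots> = 4 ^ r * (real (p choose r) * real r ^ r)"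
    using power_mult_distrib[of 2 "2::real" r] by (simp add: power_mult_distrib)
  also have "\<dots> \<le> 4 ^ r * (3 ^ r * real n ^ r)" using c by (intro mult_left_mono) auto
  also have "\<dots> = (12 * real n) ^ r" 
    using power_mult_distrib[of 4 "3::real" r] by (simp add: power_mult_distrib)
  finally show ?thesis using assms(1) by (simp add: field_simps power_divide power_mult_distrib)
qed

section \<open>Horton sets\<close>

text \<open>This is \<open>det3\<close> for the points \<open>(a, f a)\<close>,
  \<open>(b, f b)\<close>, \<open>(c, f c)\<close> on the graph of \<open>f\<close>; an index
  doubles as abscissa.\<close>

definition hdet :: "(nat \<Rightarrow> real) \<Rightarrow> nat \<Rightarrow> nat \<Rightarrow> nat \<Rightarrow> real" where
  "hdet f a b c = (real b - real a) * (f c - f a) - (f b - f a) * (real c - real a)"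

interpretation graph: orientation "hdet f" for f
proof
  fix a b c p e g :: nat
  show "hdet f a b c * hdet f e g p = hdet f b c p * hdet f e g a + hdet f c a p * hdet f e g b + hdet f a b p * hdet f e g c"
    unfolding hdet_def by algebra
qed (simp_all add: hdet_def algebra_simps)

lemma hdet_double: "hdet (\<lambda>x. f (2 * x + h)) a b c = hdet f (2 * a + h) (2 * b + h) (2 * c + h) / 2"
  by (simp add: hdet_def field_simps)

lemma hdet_affine: "hdet (\<lambda>x. d + s * f x) a b c = s * hdet f a b c"
  by (simp add: hdet_def algebra_simps)

lemma hdet_swap23: "hdet f a c b = - hdet f a b c"
  by (simp add: hdet_def algebra_simps)

text \<open>Lines through two even positions run below all odd ones, and lines through two odd positions above all even ones.\<close>

definition parity_separated :: "nat \<Rightarrow> (nat \<Rightarrow> real) \<Rightarrow> bool" where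
  "parity_separated n f \<longleftrightarrow> (\<forall>a<n. \<forall>b<n. \<forall>c<n. a < c \<longrightarrow> even c = even a \<longrightarrow> even b \<noteq> even a \<longrightarrow>
     (if even a then hdet f a c b > 0 else hdet f a c b < 0))"

text \<open>A Horton set with abscissas \<open>0, ..., 2 ^ q - 1\<close>. Each parity class is
  reindexed to consecutive integers, which by \<open>hdet_double\<close> keeps all orientation
  signs.\<close>

primrec horton :: "nat \<Rightarrow> (nat \<Rightarrow> real) \<Rightarrow> bool" where
  "horton 0 f \<longleftrightarrow> True"
| "horton (Suc q) f \<longleftrightarrow> parity_separated (2 ^ Suc q) f \<and>
     horton q (\<lambda>x. f (2 * x + 0)) \<and> horton q (\<lambda>x. f (2 * x + 1))"

lemma parity_separatedD:
  assumes "parity_separated n f" "a < c" "c < n" "b < n" "even c = even a" "even b \<noteq> even a"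
  shows "even a \<Longrightarrow> hdet f a c b > 0" "odd a \<Longrightarrow> hdet f a c b < 0"
  using assms unfolding parity_separated_def by (meson order_less_trans)+

lemma horton_half: "horton (Suc q) f \<Longrightarrow> h < 2 \<Longrightarrow> horton q (\<lambda>x. f (2 * x + h))"
  by (cases h) auto

lemma horton_affine: "horton q f \<Longrightarrow> s > 0 \<Longrightarrow> horton q (\<lambda>x. d + s * f x)"
proof (induction q arbitrary: f)
  case (Suc q)
  have "parity_separated (2 ^ Suc q) (\<lambda>x. d + s * f x)"
    using Suc.prems unfolding horton.simps parity_separated_def hdet_affine
    by (simp add: zero_less_mult_iff mult_less_0_iff)
  then show ?case using Suc.IH[of "\<lambda>x. f (2 * x + 0)"] Suc.IH[of "\<lambda>x. f (2 * x + 1)"] Suc.prems by simp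
qed simp

text \<open>Two flattened copies of a smaller Horton set are interleaved at heights 0 and 1. At
  \<open>e = 0\<close> each parity class is on a horizontal line and the separation is strict; being
  finitely many strict inequalities, it persists for small \<open>e > 0\<close>.\<close>

lemma horton_exists: "\<exists>f. horton q f"
proof (induction q)
  case (Suc q)
  then obtain g where g: "horton q g" by blast
  define F where "F e x = real (x mod 2) + e * g (x div 2)" for e x
  define N :: nat where "N = 2 ^ Suc q"
  let ?sep = "\<lambda>e a b c. a < c \<longrightarrow> even c = even a \<longrightarrow> even b \<noteq> even a \<longrightarrow>
     (if even a then hdet (F e) a c b > 0 else hdet (F e) a c b < 0)"
  have "\<forall>\<^sub>F e in at_right 0. ?sep e a b c" for a b c
  proof (cases "a < c \<and> even c = even a \<and> even b \<noteq> even a")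
    case True
    have "isCont (\<lambda>e. hdet (F e) a c b) 0"
      unfolding hdet_def F_def by (intro continuous_intros)
    then have lim: "((\<lambda>e. hdet (F e) a c b) \<longlongrightarrow> hdet (F 0) a c b) (at_right 0)"
      unfolding isCont_def filterlim_at_split by blast
    show ?thesis
    proof (cases "even a")
      case ev: True
      then have "hdet (F 0) a c b > 0" using True by (simp add: hdet_def F_def mod2_eq_if)
      from order_tendstoD(1)[OF lim this] show ?thesis using ev by (auto elim: eventually_mono)
    next
      case od: False
      then have "hdet (F 0) a c b < 0" using True by (simp add: hdet_def F_def mod2_eq_if)
      from order_tendstoD(2)[OF lim this] show ?thesis using od by (auto elim: eventually_mono)
    qed
  qed auto
  then have "\<forall>\<^sub>F e in at_right 0. \<forall>a\<in>{..<N}. \<forall>b\<in>{..<N}. \<forall>c\<in>{..<N}. ?sep e a b c"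
    by (intro eventually_ball_finite ballI finite_lessThan)
  moreover have "\<forall>\<^sub>F e in at_right (0::real). e > 0" by (rule eventually_at_right_less)
  ultimately have "\<forall>\<^sub>F e in at_right 0. e > 0 \<and> parity_separated N (F e)"
    by eventually_elim (simp add: parity_separated_def)
  then obtain e where e: "e > 0" "parity_separated N (F e)"
    using eventually_happens'[OF trivial_limit_at_right_real] by blast
  have "(\<lambda>x. F e (2 * x + 0)) = (\<lambda>x. 0 + e * g x)" "(\<lambda>x. F e (2 * x + 1)) = (\<lambda>x. 1 + e * g x)"
    by (simp_all add: F_def)
  then have "horton (Suc q) (F e)"
    unfolding horton.simps using e horton_affine[OF g e(1)] N_def by metis
  then show ?case by blast
qed simp

lemma horton_nonzero:
  assumes "horton q f" "a < 2 ^ q" "b < 2 ^ q" "c < 2 ^ q" "a \<noteq> b" "b \<noteq> c" "a \<noteq> c"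
  shows "hdet f a b c \<noteq> 0"
  using assms
proof (induction q arbitrary: f a b c)
  case (Suc q)
  have sep: "hdet f x y z \<noteq> 0"
    if "x < 2 ^ Suc q" "y < 2 ^ Suc q" "z < 2 ^ Suc q" "x \<noteq> y" "even x = even y" "even z \<noteq> even x" for x y z
  proof (cases "x < y")
    case True
    then show ?thesis
      using parity_separatedD[of "2 ^ Suc q" f x y z] Suc.prems(1) that by (cases "even x") auto
  next
    case False
    then have "hdet f y x z \<noteq> 0"
      using parity_separatedD[of "2 ^ Suc q" f y x z] Suc.prems(1) that by (cases "even y") auto
    then show ?thesis using graph.swap[of f x y z] by simp
  qed
  consider "even a = even b" "even b = even c" | "even a = even b" "even c \<noteq> even a"
    | "even b = even c" "even a \<noteq> even b" | "even a = even c" "even b \<noteq> even a" by blast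
  then show ?case
  proof cases
    case 1
    define h where "h = a mod 2"
    have "a = 2 * (a div 2) + h" "b = 2 * (b div 2) + h" "c = 2 * (c div 2) + h"
      using 1 unfolding h_def by presburger+
    then obtain a' b' c' where abc: "a = 2 * a' + h" "b = 2 * b' + h" "c = 2 * c' + h" by blast
    have "h < 2" by (simp add: h_def)
    then have "hdet (\<lambda>x. f (2 * x + h)) a' b' c' \<noteq> 0"
      using Suc.prems abc by (intro Suc.IH horton_half) auto
    then show ?thesis unfolding hdet_double abc by simp
  next
    case 2
    then show ?thesis using sep[of a b c] Suc.prems by simp
  next
    case 3
    then show ?thesis using sep[of b c a] Suc.prems graph.cyc[of f a b c] by simp
  next
    case 4
    then show ?thesis using sep[of a c b] Suc.prems hdet_swap23[of f a c b] by simp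
  qed
qed simp

lemma same_parity_image:
  assumes "\<And>x. x \<in> K \<Longrightarrow> x mod 2 = h" "h < (2::nat)"
  shows "K = (\<lambda>x. 2 * x + h) ` {x. 2 * x + h \<in> K}" "card K = card {x. 2 * x + h \<in> K}"
proof -
  show *: "K = (\<lambda>x. 2 * x + h) ` {x. 2 * x + h \<in> K}"
  proof
    show "K \<subseteq> (\<lambda>x. 2 * x + h) ` {x. 2 * x + h \<in> K}"
    proof
      fix x assume "x \<in> K"
      moreover from this have "x = 2 * (x div 2) + h" using assms(1) by (metis mult_div_mod_eq)
      ultimately show "x \<in> (\<lambda>x. 2 * x + h) ` {x. 2 * x + h \<in> K}" by (metis (mono_tags) imageI mem_Collect_eq)
    qed
  qed auto
  show "card K = card {x. 2 * x + h \<in> K}"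
    by (subst *, rule card_image) (auto simp: inj_on_def)
qed

text \<open>The sign \<open>\<sigma>\<close> treats sets with nothing above (\<open>1\<close>) and with nothing below (\<open>-1\<close>) their chords at once.\<close>

lemma horton_clique:
  assumes "horton q f" "K \<subseteq> {..<2 ^ q}" "\<sigma> = 1 \<or> \<sigma> = -1"
    and "\<And>a b c. a \<in> K \<Longrightarrow> c \<in> K \<Longrightarrow> a < b \<Longrightarrow> b < c \<Longrightarrow> \<sigma> * hdet f a b c > 0"
  shows "card K \<le> 3"
  using assms
proof (induction q arbitrary: f K)
  case 0
  then have "K \<subseteq> {0}" by auto
  then have "card K \<le> card {0::nat}" by (intro card_mono) auto
  then show ?case by simp
next
  case (Suc q)
  have sep: "parity_separated (2 ^ Suc q) f" using Suc.prems(1) by simp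
  \<comment> \<open>\<open>h\<close> is the class whose chords have the other class on the permitted
    side. Chords of the other class have all points of class \<open>h\<close> on the forbidden
    side.\<close>
  define h :: nat where "h = (if \<sigma> = 1 then 1 else 0)"
  have h2: "h < 2" by (simp add: h_def)
  have bd: "x < 2 ^ Suc q" if "x \<in> K" for x using that Suc.prems(2) by blast
  have K: "\<sigma> * hdet f a b c > 0" if "a \<in> K" "c \<in> K" "a < b" "b < c" for a b c using Suc.prems(4) that .
  have sg: "\<sigma> * hdet f a c b < 0"
    if "a < c" "c < 2 ^ Suc q" "b < 2 ^ Suc q" "a mod 2 = h" "c mod 2 = h" "b mod 2 \<noteq> h" for a b c
  proof -
    have "even c = even a" "even b \<noteq> even a" using that(4-6) h2 by presburger+
    note D = parity_separatedD[OF sep that(1-3) this]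
    from Suc.prems(3) show ?thesis
    proof
      assume "\<sigma> = 1"
      then show ?thesis using D(2) that(4) by (simp add: h_def odd_iff_mod_2_eq_one)
    next
      assume "\<sigma> = -1"
      then show ?thesis using D(1) that(4) by (simp add: h_def even_iff_mod_2_eq_zero)
    qed
  qed
  have sg': "\<sigma> * hdet f a c b > 0"
    if "a < c" "c < 2 ^ Suc q" "b < 2 ^ Suc q" "a mod 2 \<noteq> h" "c mod 2 \<noteq> h" "b mod 2 = h" for a b c
  proof -
    have "even c = even a" "even b \<noteq> even a" using that(4-6) h2 by presburger+
    note D = parity_separatedD[OF sep that(1-3) this]
    from Suc.prems(3) show ?thesis
    proof
      assume "\<sigma> = 1"
      then show ?thesis using D(1) that(4) by (simp add: h_def even_iff_mod_2_eq_zero)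
    next
      assume "\<sigma> = -1"
      then show ?thesis using D(2) that(4) by (simp add: h_def odd_iff_mod_2_eq_one)
    qed
  qed
  \<comment> \<open>A chord of two elements outside class \<open>h\<close> would span the position
    \<open>Suc a\<close>, which is in class \<open>h\<close> and on the forbidden side.\<close>
  have one: False if "a \<in> K" "c \<in> K" "a < c" "a mod 2 \<noteq> h" "c mod 2 \<noteq> h" for a c
  proof -
    have "a mod 2 = c mod 2" "Suc a mod 2 = h"
      using that(4,5) h2 mod_Suc[of a 2] by (auto simp: less_2_cases_iff mod2_eq_if split: if_splits)
    then have "Suc a < c" using that(3) by (metis Suc_lessI h2 that(5))
    have "\<sigma> * hdet f a c (Suc a) > 0" using \<open>Suc a < c\<close> \<open>Suc a mod 2 = h\<close> sg'[of a c "Suc a"] that bd[OF that(2)] by simp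
    moreover have "\<sigma> * hdet f a (Suc a) c > 0" using K[of a c "Suc a"] that \<open>Suc a < c\<close> by simp
    ultimately show False using hdet_swap23[of f a c "Suc a"] by simp
  qed
  \<comment> \<open>At distance three or more, step by two from the element in class
    \<open>h\<close> towards the other: that position is on the forbidden side of their
    chord.\<close>
  have adj: "c = Suc a" if "a \<in> K" "c \<in> K" "a < c" "a mod 2 \<noteq> c mod 2" for a c
  proof (rule ccontr)
    assume "c \<noteq> Suc a"
    have "c \<noteq> a + 2" using that(4) by auto
    then have c: "a + 2 < c" using that(3) \<open>c \<noteq> Suc a\<close> by simp
    show False
    proof (cases "a mod 2 = h")
      case True
      then have "\<sigma> * hdet f a (a + 2) c < 0" using sg[of a "a + 2" c] c bd[OF that(2)] that(4) by simp
      then show False using K[of a c "a + 2"] that c by simp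
    next
      case False
      then have "c mod 2 = h" using that(4) h2 by (auto simp: less_2_cases_iff mod2_eq_if split: if_splits)
      moreover have "(c - 2) mod 2 = c mod 2" using c le_mod_geq[of 2 c] by simp
      ultimately have "\<sigma> * hdet f (c - 2) c a < 0"
        using sg[of "c - 2" c a] c bd[OF that(2)] that(4) by simp
      moreover have "a < c - 2" "c - 2 < c" using c by simp_all
      ultimately show False using K[of a c "c - 2"] that graph.cyc[of f a "c - 2" c] by simp
    qed
  qed
  show ?case
  proof (cases "\<exists>e\<in>K. e mod 2 \<noteq> h")
    case True
    then obtain e where e: "e \<in> K" "e mod 2 \<noteq> h" by blast
    have "K \<subseteq> {e - 1, e, e + 1}"
    proof
      fix x assume x: "x \<in> K"
      show "x \<in> {e - 1, e, e + 1}"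
      proof (cases "x mod 2 = h")
        case True
        then show ?thesis using adj[of x e] adj[of e x] e x by (cases x e rule: linorder_cases) auto
      next
        case False
        then show ?thesis using one[of x e] one[of e x] e x by (cases x e rule: linorder_cases) auto
      qed
    qed
    then have "card K \<le> card {e - 1, e, e + 1}" by (intro card_mono) auto
    also have "\<dots> \<le> 3" by (simp add: card_insert_if)
    finally show ?thesis .
  next
    case False
    then have "card K = card {x. 2 * x + h \<in> K}" using same_parity_image(2) h2 by blast
    also have "\<dots> \<le> 3"
    proof (rule Suc.IH[OF horton_half[OF Suc.prems(1) h2] _ Suc.prems(3)])
      show "{x. 2 * x + h \<in> K} \<subseteq> {..<2 ^ q}" using bd by fastforce
      fix a b c assume "a \<in> {x. 2 * x + h \<in> K}" "c \<in> {x. 2 * x + h \<in> K}" "a < b" "b < c"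
      then show "\<sigma> * hdet (\<lambda>x. f (2 * x + h)) a b c > 0"
        using K[of "2 * a + h" "2 * c + h" "2 * b + h"] unfolding hdet_double by simp
    qed
    finally show ?thesis .
  qed
qed

text \<open>Within one parity class the induction hypothesis applies. Otherwise an odd member lies
  above all even chords, so an even point above a chord of even members would be inside a triangle;
  \<open>horton_clique\<close> leaves at most three even members. The odd half is the same upside
  down.\<close>

lemma horton_void_card:
  assumes "horton q f" "X \<subseteq> {..<2 ^ q}" "graph.void f {..<2 ^ q} X"
  shows "card X \<le> 6"
  using assms
proof (induction q arbitrary: f X)
  case 0
  then have "X \<subseteq> {0}" by auto
  then have "card X \<le> card {0::nat}" by (intro card_mono) auto
  then show ?case by simp
next
  case (Suc q)
  have sep: "parity_separated (2 ^ Suc q) f" using Suc.prems(1) by simp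
  let ?H = "\<lambda>h. {x. 2 * x + h \<in> X}"
  have sub: "?H h \<subseteq> {..<2 ^ q}" for h using Suc.prems(2) by fastforce
  have h01: "2 * x + h < 2 ^ Suc q" if "x < 2 ^ q" "h < 2" for x h :: nat using that by simp
  have void: "graph.void (\<lambda>x. f (2 * x + h)) {..<2 ^ q} (?H h)" if "h < 2" for h
    unfolding graph.void_def graph.inside_def hdet_double
  proof (intro ballI notI)
    fix a b c p assume *: "a \<in> ?H h" "b \<in> ?H h" "c \<in> ?H h" "p \<in> {..<2 ^ q}"
      and "0 < hdet f (2 * a + h) (2 * b + h) (2 * p + h) / 2 \<and>
        0 < hdet f (2 * b + h) (2 * c + h) (2 * p + h) / 2 \<and>
        0 < hdet f (2 * c + h) (2 * a + h) (2 * p + h) / 2"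
    then have "graph.inside f (2 * a + h) (2 * b + h) (2 * c + h) (2 * p + h)"
      unfolding graph.inside_def by simp
    moreover have "2 * p + h \<in> {..<2 ^ Suc q}" using h01[OF _ that] * by blast
    moreover have "2 * a + h \<in> X" "2 * b + h \<in> X" "2 * c + h \<in> X" using * by simp_all
    ultimately show False using Suc.prems(3) unfolding graph.void_def by blast
  qed
  have nv: False
    if "a \<in> X" "b \<in> X" "c \<in> X" "p < 2 ^ Suc q" "hdet f a b p > 0" "hdet f b c p > 0" "hdet f c a p > 0" for a b c p
    using Suc.prems(3) that unfolding graph.void_def graph.inside_def by blast
  have half: "card {x \<in> X. x mod 2 = h} = card (?H h)" if "h < 2" for h
  proof -
    have "card {x \<in> X. x mod 2 = h} = card {x. 2 * x + h \<in> {x \<in> X. x mod 2 = h}}"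
      using that by (intro same_parity_image(2)) auto
    also have "{x. 2 * x + h \<in> {x \<in> X. x mod 2 = h}} = ?H h" using that by auto
    finally show ?thesis .
  qed
  have "X = {x \<in> X. x mod 2 = 0} \<union> {x \<in> X. x mod 2 = 1}" by auto
  then have "card X \<le> card {x \<in> X. x mod 2 = 0} + card {x \<in> X. x mod 2 = 1}" by (metis card_Un_le)
  then have "card X \<le> card (?H 0) + card (?H 1)" using half[of 0] half[of 1] by simp
  moreover have "card (?H 0) + card (?H 1) \<le> 6"
  proof (cases "?H 0 = {} \<or> ?H 1 = {}")
    case True
    moreover have "card (?H h) \<le> 6" if "h < 2" for h
      using Suc.IH[OF horton_half[OF Suc.prems(1) that] sub void[OF that]] .
    note this[of 0] this[of 1]
    ultimately show ?thesis by auto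
  next
    case False
    then obtain e d where ed: "2 * e \<in> X" "2 * d + 1 \<in> X" by auto
    then have edN: "2 * e < 2 ^ Suc q" "2 * d + 1 < 2 ^ Suc q" using Suc.prems(2) by (meson lessThan_iff subsetD)+
    have "card (?H 0) \<le> 3"
    proof (rule horton_clique[OF horton_half[OF Suc.prems(1)] sub, of 0 1])
      fix a b c assume abc: "a \<in> ?H 0" "c \<in> ?H 0" "a < b" "b < c"
      then have cN: "2 * c < 2 ^ Suc q" using Suc.prems(2) by auto
      then have bN: "2 * b < 2 ^ Suc q" using abc by simp
      show "1 * hdet (\<lambda>x. f (2 * x + 0)) a b c > 0"
      proof (rule ccontr)
        assume "\<not> ?thesis"
        then have "\<not> hdet f (2 * a) (2 * b) (2 * c) > 0" using hdet_double[of f 0 a b c] by simp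
        moreover have "hdet f (2 * a) (2 * b) (2 * c) \<noteq> 0"
          using horton_nonzero[OF Suc.prems(1), of "2 * a" "2 * b" "2 * c"] abc cN by simp
        ultimately have "hdet f (2 * a) (2 * c) (2 * b) > 0" using hdet_swap23[of f "2 * a" "2 * c" "2 * b"] by simp
        moreover have "hdet f (2 * b) (2 * c) (2 * d + 1) > 0"
          using parity_separatedD(1)[OF sep, of "2 * b" "2 * c" "2 * d + 1"] abc cN edN by simp
        then have "hdet f (2 * c) (2 * d + 1) (2 * b) > 0" using graph.cyc[of f "2 * b" "2 * c" "2 * d + 1"] by simp
        moreover have "hdet f (2 * a) (2 * b) (2 * d + 1) > 0"
          using parity_separatedD(1)[OF sep, of "2 * a" "2 * b" "2 * d + 1"] abc bN edN by simp
        then have "hdet f (2 * d + 1) (2 * a) (2 * b) > 0"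
          using graph.cyc[of f "2 * d + 1" "2 * a" "2 * b"] by simp
        ultimately show False using nv[of "2 * a" "2 * c" "2 * d + 1" "2 * b"] abc ed bN by simp
      qed
    qed auto
    moreover have "card (?H 1) \<le> 3"
    proof (rule horton_clique[OF horton_half[OF Suc.prems(1)] sub, of 1 "-1"])
      fix a b c assume abc: "a \<in> ?H 1" "c \<in> ?H 1" "a < b" "b < c"
      define a' b' c' where "a' = 2 * a + 1" and "b' = 2 * b + 1" and "c' = 2 * c + 1"
      have X: "a' \<in> X" "c' \<in> X" and lt: "a' < b'" "b' < c'" and od: "odd a'" "odd b'" "odd c'"
        using abc by (auto simp: a'_def b'_def c'_def)
      have cN: "c' < 2 ^ Suc q" using X Suc.prems(2) by blast
      then have bN: "b' < 2 ^ Suc q" using lt by simp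
      show "-1 * hdet (\<lambda>x. f (2 * x + 1)) a b c > 0"
      proof (rule ccontr)
        assume "\<not> ?thesis"
        then have "\<not> hdet f a' b' c' < 0" using hdet_double[of f 1 a b c] by (simp add: a'_def b'_def c'_def)
        moreover have "hdet f a' b' c' \<noteq> 0"
          using horton_nonzero[OF Suc.prems(1), of a' b' c'] lt cN by simp
        ultimately have "hdet f c' a' b' > 0" using graph.cyc[of f c' a' b'] by simp
        moreover have "hdet f b' c' (2 * e) < 0"
          using parity_separatedD(2)[OF sep, of b' c' "2 * e"] od lt cN edN by simp
        then have "hdet f (2 * e) c' b' > 0"
          using graph.cyc[of f b' c' "2 * e"] graph.swap[of f "2 * e" c' b'] by linarith
        moreover have "hdet f a' b' (2 * e) < 0"
          using parity_separatedD(2)[OF sep, of a' b' "2 * e"] od lt bN edN by simp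
        then have "hdet f a' (2 * e) b' > 0" using hdet_swap23[of f a' b' "2 * e"] by linarith
        ultimately show False using nv[of c' a' "2 * e" b'] X ed bN by simp
      qed
    qed auto
    ultimately show ?thesis by simp
  qed
  ultimately show ?case by simp
qed

section \<open>Clusters along a parabola\<close>

text \<open>Take the leftmost vertex \<open>a\<close> of a counterclockwise triangle around
  \<open>p\<close>. If the middle vertex is below the long edge, \<open>p\<close> is above one of
  the two lower edges; if it is above, it violates the hypothesis itself.\<close>

lemma void_if_below:
  assumes inj: "\<And>a b. a \<in> P \<Longrightarrow> b \<in> P \<Longrightarrow> a$1 = b$1 \<Longrightarrow> a = b" and "X \<subseteq> P"
    and below: "\<And>a c p. a \<in> X \<Longrightarrow> c \<in> X \<Longrightarrow> p \<in> P \<Longrightarrow> a$1 < p$1 \<Longrightarrow> p$1 < c$1 \<Longrightarrow> det3 a p c > 0"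
  shows "plane.void P X"
proof -
  have key: False
    if X: "a \<in> X" "b \<in> X" "c \<in> X" and p: "p \<in> P" and i: "plane.inside a b c p" and lt: "a$1 < b$1" "a$1 < c$1"
    for a b c p
  proof -
    have d: "det3 a b p > 0" "det3 b c p > 0" "det3 c a p > 0" using i by (auto simp: plane.inside_def)
    have abc: "det3 a b c > 0" using i by (rule plane.inside_ori)
    have "det3 a b c * (p$1 - a$1) = det3 c a p * (b$1 - a$1) + det3 a b p * (c$1 - a$1)"
      unfolding det3_def by algebra
    also have "\<dots> > 0" using d lt by (intro add_pos_pos mult_pos_pos) auto
    finally have ap: "a$1 < p$1" using abc by (simp add: zero_less_mult_iff)
    have "b \<noteq> c" using abc by auto
    then consider "b$1 < c$1" | "c$1 < b$1" using inj[of b c] X assms(2) by fastforce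
    then show False
    proof cases
      case 1
      have "det3 a b c * (c$1 - p$1) = det3 b c p * (c$1 - a$1) + det3 c a p * (c$1 - b$1)"
        unfolding det3_def by algebra
      also have "\<dots> > 0" using d lt 1 by (intro add_pos_pos mult_pos_pos) auto
      finally have pc: "p$1 < c$1" using abc by (simp add: zero_less_mult_iff)
      have "p \<noteq> b" using d by auto
      then consider "p$1 < b$1" | "b$1 < p$1" using inj[of b p] X p assms(2) by fastforce
      then show False
      proof cases
        case 1
        then have "det3 a p b > 0" using below[of a b p] X p ap by blast
        then show False using d(1) by (simp add: det3_def algebra_simps)
      next
        case 2
        then have "det3 b p c > 0" using below[of b c p] X p pc by blast
        then show False using d(2) by (simp add: det3_def algebra_simps)
      qed
    next
      case 2
      then have "det3 a c b > 0" using below[of a b c] X lt assms(2) by blast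
      then show False using abc by (simp add: det3_def algebra_simps)
    qed
  qed
  show ?thesis unfolding plane.void_def
  proof (intro ballI notI)
    fix a b c p assume X: "a \<in> X" "b \<in> X" "c \<in> X" and p: "p \<in> P" and i: "plane.inside a b c p"
    have rot: "plane.inside b c a p" "plane.inside c a b p" using i by (auto simp: plane.inside_def)
    have "det3 a b c > 0" using i by (rule plane.inside_ori)
    then have "a \<noteq> b" "b \<noteq> c" "a \<noteq> c" by auto
    then have "a$1 \<noteq> b$1" "b$1 \<noteq> c$1" "a$1 \<noteq> c$1" using inj X assms(2) by blast+
    then consider "a$1 < b$1" "a$1 < c$1" | "b$1 < c$1" "b$1 < a$1" | "c$1 < a$1" "c$1 < b$1" by linarith
    then show False
      using key[OF X p i] key[OF X(2,3,1) p rot(1)] key[OF X(3,1,2) p rot(2)] by cases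
  qed
qed

section \<open>Abstract cluster arrangements\<close>

definition cluster_size :: "nat \<Rightarrow> nat \<Rightarrow> nat \<Rightarrow> nat" where
  "cluster_size t q i = (if i < t then 2 ^ q else 1)"

text \<open>A pair \<open>(i, x)\<close> stands for point \<open>x\<close> of cluster
  \<open>i\<close>. The first \<open>t\<close> clusters are Horton sets, the other \<open>s\<close>
  are single points.\<close>

definition idx :: "nat \<Rightarrow> nat \<Rightarrow> nat \<Rightarrow> (nat \<times> nat) set" where
  "idx t s q = (SIGMA i:{..<t + s}. {..<cluster_size t q i})"

definition before :: "nat \<times> nat \<Rightarrow> nat \<times> nat \<Rightarrow> bool" where
  "before u v \<longleftrightarrow> fst u < fst v \<or> fst u = fst v \<and> snd u < snd v"

lemma before_linear: "u \<noteq> v \<Longrightarrow> before u v \<or> before v u"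
  by (auto simp: before_def prod_eq_iff)

lemma sum_if_less: "(\<Sum>i<t + s. if i < t then A else B) = t * A + s * (B::nat)"
proof (induction s)
  case 0
  have "(\<Sum>i<t. if i < t then A else B) = (\<Sum>i<t. A)" by (intro sum.cong) auto
  then show ?case by simp
qed simp

lemma finite_idx: "finite (idx t s q)"
  by (simp add: idx_def)

lemma card_idx: "card (idx t s q) = t * 2 ^ q + s"
proof -
  have "card (idx t s q) = (\<Sum>i<t + s. card {..<cluster_size t q i})"
    unfolding idx_def by (intro card_SigmaI) auto
  also have "\<dots> = (\<Sum>i<t + s. if i < t then 2 ^ q else 1)"
    by (intro sum.cong) (auto simp: cluster_size_def)
  finally show ?thesis unfolding sum_if_less by simp
qed

text \<open>Only the order data of the construction: abscissas are lexicographic, a triple spread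
  over two or three clusters turns left, and each cluster has the orientations of a Horton
  set.\<close>

locale clusters =
  fixes t s q :: nat and f :: "nat \<Rightarrow> real" and pt :: "nat \<times> nat \<Rightarrow> real^2" and \<kappa> :: real
  assumes horton: "horton q f" and kappa: "\<kappa> > 0"
    and x_mono: "\<And>u v. u \<in> idx t s q \<Longrightarrow> v \<in> idx t s q \<Longrightarrow> before u v \<Longrightarrow> pt u $ 1 < pt v $ 1"
    and ccw_sorted: "\<And>u v w. u \<in> idx t s q \<Longrightarrow> v \<in> idx t s q \<Longrightarrow> w \<in> idx t s q \<Longrightarrow>
      before u v \<Longrightarrow> before v w \<Longrightarrow> fst u \<noteq> fst w \<Longrightarrow> det3 (pt u) (pt v) (pt w) > 0"
    and same: "\<And>i x y z. det3 (pt (i, x)) (pt (i, y)) (pt (i, z)) = \<kappa> * hdet f x y z"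
begin

abbreviation "I \<equiv> idx t s q"
abbreviation "P \<equiv> pt ` I"

lemma x_inj: "u \<in> I \<Longrightarrow> v \<in> I \<Longrightarrow> pt u $ 1 = pt v $ 1 \<Longrightarrow> u = v"
  by (metis before_linear less_irrefl x_mono)

lemma inj_pt: "inj_on pt I"
  using x_inj by (intro inj_onI) simp

lemma x_less: "u \<in> I \<Longrightarrow> v \<in> I \<Longrightarrow> pt u $ 1 < pt v $ 1 \<Longrightarrow> before u v"
  by (metis before_linear less_asym less_irrefl x_mono)

lemma snd_less: "(i, x) \<in> I \<Longrightarrow> i < t \<Longrightarrow> x < 2 ^ q"
  by (simp add: idx_def cluster_size_def)

lemma det3_nonzero:
  assumes "u \<in> I" "v \<in> I" "w \<in> I" "before u v" "before v w"
  shows "det3 (pt u) (pt v) (pt w) \<noteq> 0"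
proof (cases "fst u = fst w")
  case True
  moreover from this have "fst u = fst v" using assms(4,5) by (auto simp: before_def)
  ultimately obtain i x y z where e: "u = (i, x)" "v = (i, y)" "w = (i, z)" by (metis prod.collapse)
  then have lt: "x < y" "y < z" using assms(4,5) by (simp_all add: before_def)
  have "i < t" using assms(1,3) e lt by (auto simp: idx_def cluster_size_def split: if_splits)
  then have "z < 2 ^ q" using snd_less[of i z] assms(3) e by simp
  then have "hdet f x y z \<noteq> 0" using horton_nonzero[OF horton, of x y z] lt by simp
  then show ?thesis using same kappa e by simp
next
  case False
  then show ?thesis using ccw_sorted[OF assms] by simp
qed

lemma genpos: "plane.genpos P"
  unfolding plane.genpos_def
proof (intro ballI impI, rule ccontr)
  fix a b c assume abc: "a \<in> P" "b \<in> P" "c \<in> P" "det3 a b c = 0" "\<not> (a = b \<or> b = c \<or> a = c)"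
  then obtain u v w where u: "u \<in> I" "v \<in> I" "w \<in> I" "a = pt u" "b = pt v" "c = pt w" by blast
  have z: "det3 a c b = 0" "det3 b a c = 0" "det3 b c a = 0" "det3 c a b = 0" "det3 c b a = 0"
    using abc(4) by (simp_all add: det3_def algebra_simps)
  have "u \<noteq> v" "v \<noteq> w" "u \<noteq> w" using abc(5) u by auto
  then consider "before u v" "before v w" | "before u w" "before w v" | "before v u" "before u w"
    | "before v w" "before w u" | "before w u" "before u v" | "before w v" "before v u"
    using before_linear[of u v] before_linear[of v w] before_linear[of u w] by blast
  then show False
    using abc(4) z u det3_nonzero[of u v w] det3_nonzero[of u w v] det3_nonzero[of v u w]
      det3_nonzero[of v w u] det3_nonzero[of w u v] det3_nonzero[of w v u] by cases simp_all
qed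

text \<open>A cyclic shift reduces to \<open>ccw_sorted\<close>, whether \<open>w\<close> is to the
  left or to the right: the other clusters are above the lines spanned by cluster
  \<open>i\<close>.\<close>

lemma det3_other_cluster:
  assumes "(i, x) \<in> I" "(i, y) \<in> I" "x < y" "w \<in> I" "fst w \<noteq> i"
  shows "det3 (pt (i, x)) (pt (i, y)) (pt w) > 0"
proof (cases "fst w < i")
  case True
  then have "det3 (pt w) (pt (i, x)) (pt (i, y)) > 0"
    using assms by (intro ccw_sorted) (auto simp: before_def)
  then show ?thesis using plane.cyc[of "pt w"] by simp
next
  case False
  then show ?thesis using assms by (intro ccw_sorted) (auto simp: before_def)
qed

text \<open>If \<open>X\<close> has a point \<open>w\<close> outside cluster \<open>i\<close>, then
  a cluster point above a chord of \<open>X\<close> in that cluster would be inside a triangle with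
  \<open>w\<close>, so \<open>horton_clique\<close> allows at most three points there. The 6 is for
  a set inside a single cluster, by \<open>horton_void_card\<close>.\<close>

lemma card_void_le:
  assumes X: "X \<subseteq> P" "plane.void P X"
  shows "card X \<le> max 6 (3 * t + s)"
proof -
  define U where "U = {u \<in> I. pt u \<in> X}"
  define K where "K i = {x. (i, x) \<in> U}" for i
  have XU: "X = pt ` U" using X(1) by (auto simp: U_def)
  have UI: "U \<subseteq> I" by (simp add: U_def)
  have cX: "card X = card U" using XU inj_on_subset[OF inj_pt UI] by (simp add: card_image)
  have US: "U = (SIGMA i:{..<t + s}. K i)" using UI by (auto simp: K_def idx_def)
  have finK: "finite (K i)" for i
    by (rule finite_subset[of _ "snd ` I"]) (use UI finite_idx in \<open>force simp: K_def\<close>)+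
  have Kq: "K i \<subseteq> {..<2 ^ q}" if "i < t" for i using UI snd_less that by (auto simp: K_def)
  have K1: "card (K i) \<le> 1" if "\<not> i < t" for i
  proof -
    have "K i \<subseteq> {0}" using UI that by (auto simp: K_def idx_def cluster_size_def)
    then have "card (K i) \<le> card {0::nat}" by (intro card_mono) auto
    then show ?thesis by simp
  qed
  have inX: "pt (i, x) \<in> X" if "x \<in> K i" for i x using that XU by (auto simp: K_def)
  have nv: False if "u \<in> X" "v \<in> X" "w \<in> X" "p \<in> P" "det3 u v p > 0" "det3 v w p > 0" "det3 w u p > 0" for u v w p
    using X(2) that unfolding plane.void_def plane.inside_def by blast
  show ?thesis
  proof (cases "\<exists>i. \<forall>u\<in>U. fst u = i")
    case True
    then obtain i where i: "\<forall>u\<in>U. fst u = i" by blast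
    then have "U = Pair i ` K i" by (force simp: K_def)
    then have cU: "card U = card (K i)" by (simp add: card_image inj_on_def)
    show ?thesis
    proof (cases "i < t")
      case it: True
      have "graph.void f {..<2 ^ q} (K i)" unfolding graph.void_def
      proof (intro ballI notI)
        fix a b c p assume *: "a \<in> K i" "b \<in> K i" "c \<in> K i" "p \<in> {..<2 ^ q}" "graph.inside f a b c p"
        have "pt (i, p) \<in> P" using *(4) it by (auto simp: idx_def cluster_size_def)
        then show False
          using nv[of "pt (i, a)" "pt (i, b)" "pt (i, c)" "pt (i, p)"] inX * kappa
          by (simp add: same graph.inside_def)
      qed
      then have "card (K i) \<le> 6" using horton_void_card[OF horton Kq[OF it]] by blast
      then show ?thesis using cX cU by simp
    next
      case False
      then show ?thesis using cX cU K1[of i] by simp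
    qed
  next
    case False
    have "card (K i) \<le> (if i < t then 3 else 1)" for i
    proof (cases "i < t")
      case it: True
      obtain w where w: "w \<in> U" "fst w \<noteq> i" using False by blast
      have "card (K i) \<le> 3"
      proof (rule horton_clique[OF horton Kq[OF it], of 1])
        fix a b c assume abc: "a \<in> K i" "c \<in> K i" "a < b" "b < c"
        have I: "(i, a) \<in> I" "(i, c) \<in> I" using abc UI by (auto simp: K_def)
        then have cq: "c < 2 ^ q" using snd_less it by blast
        then have bI: "(i, b) \<in> I" using I(2) abc by (auto simp: idx_def)
        have wI: "w \<in> I" using w UI by blast
        show "1 * hdet f a b c > 0"
        proof (rule ccontr)
          assume "\<not> 1 * hdet f a b c > 0"
          moreover have "hdet f a b c \<noteq> 0" using horton_nonzero[OF horton, of a b c] abc cq by simp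
          ultimately have "hdet f a c b > 0" using hdet_swap23[of f a c b] by simp
          then have 1: "det3 (pt (i, a)) (pt (i, c)) (pt (i, b)) > 0" using same kappa by simp
          have 2: "det3 (pt (i, c)) (pt w) (pt (i, b)) > 0"
            using det3_other_cluster[OF bI I(2) abc(4) wI w(2)] plane.cyc by metis
          have 3: "det3 (pt w) (pt (i, a)) (pt (i, b)) > 0"
            using det3_other_cluster[OF I(1) bI abc(3) wI w(2)] plane.cyc by metis
          have "pt w \<in> X" "pt (i, b) \<in> P" using w XU bI by auto
          then show False using nv[OF inX[OF abc(1)] inX[OF abc(2)]] 1 2 3 by blast
        qed
      qed simp
      then show ?thesis using it by simp
    qed (use K1 in simp)
    then have "(\<Sum>i<t + s. card (K i)) \<le> (\<Sum>i<t + s. if i < t then 3 else 1)" by (intro sum_mono)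
    then have "(\<Sum>i<t + s. card (K i)) \<le> t * 3 + s * 1" unfolding sum_if_less .
    moreover have "card U = (\<Sum>i<t + s. card (K i))" unfolding US using finK by (intro card_SigmaI) auto
    ultimately show ?thesis using cX by simp
  qed
qed

section \<open>Many holes with \<open>3 * t + s\<close> vertices\<close>

text \<open>Three consecutive positions with odd ends, so that the middle one is even and lies below
  the chord of the other two.\<close>

definition triples :: "(nat \<Rightarrow> nat) \<Rightarrow> (nat \<times> nat) set" where
  "triples e = (SIGMA i:{..<t + s}. if i < t then {2 * e i - 1, 2 * e i, 2 * e i + 1} else {0})"

context
  fixes e :: "nat \<Rightarrow> nat" assumes e: "e \<in> {..<t} \<rightarrow>\<^sub>E {1..<2 ^ (q - 1)}"
begin

lemma e_bounds: "i < t \<Longrightarrow> 1 \<le> e i \<and> 2 * e i + 1 < 2 ^ q"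
proof -
  assume i: "i < t"
  have "e i \<in> {1..<2 ^ (q - 1)}" using PiE_mem[OF e, of i] i by blast
  then have e1: "1 \<le> e i" "e i < 2 ^ (q - 1)" unfolding atLeastLessThan_iff by blast+
  show ?thesis
  proof (cases q)
    case 0
    then show ?thesis using e1 by simp
  next
    case (Suc q')
    then have "e i < 2 ^ q'" using e1 by simp
    then show ?thesis using e1(1) Suc by simp
  qed
qed

lemma triples_subset: "triples e \<subseteq> I"
proof
  fix u assume u: "u \<in> triples e"
  obtain i x where ix: "u = (i, x)" by (cases u)
  show "u \<in> I"
  proof (cases "i < t")
    case True
    then show ?thesis using u ix e_bounds[OF True] by (auto simp: triples_def idx_def cluster_size_def)
  next
    case False
    then show ?thesis using u ix by (auto simp: triples_def idx_def cluster_size_def)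
  qed
qed

lemma card_triples: "card (triples e) = 3 * t + s"
proof -
  have "card (triples e) = (\<Sum>i<t + s. card (if i < t then {2 * e i - 1, 2 * e i, 2 * e i + 1} else {0}))"
    unfolding triples_def by (intro card_SigmaI) auto
  also have "\<dots> = (\<Sum>i<t + s. if i < t then 3 else 1)"
  proof (intro sum.cong refl)
    fix i
    show "card (if i < t then {2 * e i - 1, 2 * e i, 2 * e i + 1} else {0}) = (if i < t then 3 else 1)"
      using e_bounds[of i] by (auto simp: card_insert_if)
  qed
  finally show ?thesis unfolding sum_if_less by simp
qed

text \<open>Between the ends of a chord joining two clusters, all points are below it by
  \<open>ccw_sorted\<close>. Within a cluster, only the middle position of a triple is strictly
  between two of its members, and parity separation puts it below.\<close>

lemma void_triples: "plane.void P (pt ` triples e)"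
proof (rule void_if_below)
  show "pt ` triples e \<subseteq> P" using triples_subset by blast
  show "a = b" if "a \<in> P" "b \<in> P" "a$1 = b$1" for a b using that x_inj by blast
  fix a c p assume *: "a \<in> pt ` triples e" "c \<in> pt ` triples e" "p \<in> P" "a$1 < p$1" "p$1 < c$1"
  then obtain u v w where u: "u \<in> triples e" "w \<in> triples e" "v \<in> I" and pts: "a = pt u" "c = pt w" "p = pt v" by blast
  have uI: "u \<in> I" "w \<in> I" using u triples_subset by auto
  have b: "before u v" "before v w" using * x_less uI u pts by auto
  show "det3 a p c > 0"
  proof (cases "fst u = fst w")
    case False
    then show ?thesis using ccw_sorted uI u b pts by simp
  next
    case True
    moreover from this have "fst u = fst v" using b by (auto simp: before_def)
    ultimately obtain i x y z where e: "u = (i, x)" "v = (i, y)" "w = (i, z)" by (metis prod.collapse)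
    then have lt: "x < y" "y < z" using b by (simp_all add: before_def)
    have i: "i < t" using uI e lt by (auto simp: idx_def cluster_size_def split: if_splits)
    have "x \<in> {2 * e i - 1, 2 * e i, 2 * e i + 1}" "z \<in> {2 * e i - 1, 2 * e i, 2 * e i + 1}"
      using u e i by (auto simp: triples_def)
    then have xyz: "x = 2 * e i - 1" "y = 2 * e i" "z = 2 * e i + 1" using lt by auto
    have eb: "1 \<le> e i" "2 * e i + 1 < 2 ^ q" using e_bounds[OF i] by auto
    then obtain q' where q': "q = Suc q'" by (cases q) auto
    then have "parity_separated (2 ^ q) f" using horton by simp
    then have "hdet f x z y < 0"
      using parity_separatedD(2)[of "2 ^ q" f x z y] eb xyz by simp
    then have "hdet f x y z > 0" using hdet_swap23[of f x y z] by simp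
    then show ?thesis using same kappa pts e by simp
  qed
qed

end

text \<open>The largest position chosen in cluster \<open>i\<close> reveals \<open>e i\<close>, so
  different choices give different sets; each of the \<open>t\<close> clusters has
  \<open>2 ^ (q - 1) - 1\<close> choices.\<close>

lemma card_triples_family:
  "(2 ^ (q - 1) - 1) ^ t \<le> card {X. X \<subseteq> P \<and> card X = 3 * t + s \<and> plane.void P X}"
proof -
  let ?E = "{..<t} \<rightarrow>\<^sub>E {1..<(2::nat) ^ (q - 1)}"
  let ?A = "{X. X \<subseteq> P \<and> card X = 3 * t + s \<and> plane.void P X}"
  have "inj_on (\<lambda>e. pt ` triples e) ?E"
  proof (rule inj_onI)
    fix e e' assume E: "e \<in> ?E" "e' \<in> ?E" and eq: "pt ` triples e = pt ` triples e'"
    have eq: "triples e = triples e'"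
      using eq inj_on_image_eq_iff[OF inj_pt triples_subset[OF E(1)] triples_subset[OF E(2)]] by simp
    show "e = e'"
    proof (rule PiE_ext[OF E])
      fix i assume "i \<in> {..<t}"
      then have i: "i < t" by simp
      have "a i \<le> b i" if "triples a = triples b" for a b
      proof -
        have "(i, 2 * a i + 1) \<in> triples b" unfolding that[symmetric] using i by (simp add: triples_def)
        then show ?thesis using i by (auto simp: triples_def)
      qed
      then show "e i = e' i" using eq by (simp add: antisym)
    qed
  qed
  moreover have "(\<lambda>e. pt ` triples e) ` ?E \<subseteq> ?A"
  proof
    fix X assume "X \<in> (\<lambda>e. pt ` triples e) ` ?E"
    then obtain e where e: "e \<in> ?E" "X = pt ` triples e" by blast
    have "card X = 3 * t + s"
      using card_image[OF inj_on_subset[OF inj_pt triples_subset[OF e(1)]]] card_triples[OF e(1)] e(2) by simp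
    then show "X \<in> ?A" using e triples_subset[OF e(1)] void_triples[OF e(1)] by blast
  qed
  moreover have "finite ?A"
    by (rule finite_subset[of _ "Pow P"]) (use finite_idx in auto)
  ultimately have "card ?E \<le> card ?A" by (rule card_inj_on_le)
  then show ?thesis by (simp add: card_PiE)
qed

lemma holes_lower:
  assumes "3 * t + s \<ge> 6"
  shows "finite P" "general_position P" "card P = t * 2 ^ q + s" "holes (3 * t + s + 1) P = {}"
    "(2 ^ (q - 1) - 1) ^ t \<le> card (holes (3 * t + s) P)"
proof -
  show "finite P" using finite_idx by simp
  show "general_position P" using genpos general_position_iff by blast
  show "card P = t * 2 ^ q + s" using card_image[OF inj_pt] card_idx by simp
  have "card X \<noteq> 3 * t + s + 1" if "X \<subseteq> P" "plane.void P X" for X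
    using card_void_le[OF that] assms by simp
  moreover have "holes (3 * t + s + 1) P = {X. X \<subseteq> P \<and> card X = 3 * t + s + 1 \<and> plane.void P X}"
    using assms by (intro holes_eq_void[OF genpos]) simp
  ultimately show "holes (3 * t + s + 1) P = {}" by blast
  have "holes (3 * t + s) P = {X. X \<subseteq> P \<and> card X = 3 * t + s \<and> plane.void P X}"
    using assms by (intro holes_eq_void[OF genpos]) simp
  then show "(2 ^ (q - 1) - 1) ^ t \<le> card (holes (3 * t + s) P)" using card_triples_family by simp
qed

end

text \<open>For small \<open>d\<close>, cluster \<open>i\<close> lies close to the tangent at \<open>(i, i\<^sup>2)\<close> of the parabola; the Horton set contributes only at
  order \<open>d\<^sup>2\<close>, which is negligible except within the cluster.\<close>

definition cluster_pt :: "(nat \<Rightarrow> real) \<Rightarrow> real \<Rightarrow> nat \<times> nat \<Rightarrow> real^2" where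
  "cluster_pt f d u = vector [real (fst u) + d * real (snd u),
     real (fst u) ^ 2 + 2 * real (fst u) * d * real (snd u) + d ^ 2 * f (snd u)]"

lemma cluster_pt_nth [simp]:
  "cluster_pt f d u $ 1 = real (fst u) + d * real (snd u)"
  "cluster_pt f d u $ 2 = real (fst u) ^ 2 + 2 * real (fst u) * d * real (snd u) + d ^ 2 * f (snd u)"
  by (simp_all add: cluster_pt_def)

lemma det3_cluster_pt_same:
  "det3 (cluster_pt f d (i, x)) (cluster_pt f d (i, y)) (cluster_pt f d (i, z)) = d ^ 3 * hdet f x y z"
  by (simp add: det3_def hdet_def algebra_simps power2_eq_square power3_eq_cube)

lemma eventually_at_right_pos:
  fixes g :: "real \<Rightarrow> real"
  assumes "isCont g 0" "g 0 > 0"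
  shows "\<forall>\<^sub>F d in at_right 0. g d > 0"
proof -
  have "(g \<longlongrightarrow> g 0) (at_right 0)" using assms(1) unfolding isCont_def filterlim_at_split by blast
  then show ?thesis using assms(2) by (rule order_tendstoD)
qed

lemma eventually_x_mono:
  assumes "before u v"
  shows "\<forall>\<^sub>F d in at_right 0. cluster_pt f d u $ 1 < cluster_pt f d v $ 1"
proof (cases "fst u < fst v")
  case True
  have "\<forall>\<^sub>F d in at_right 0. real (fst v) + d * real (snd v) - (real (fst u) + d * real (snd u)) > 0"
    using True by (intro eventually_at_right_pos continuous_intros) simp
  then show ?thesis by eventually_elim simp
next
  case False
  have "\<forall>\<^sub>F d in at_right (0::real). d > 0" by (rule eventually_at_right_less)
  then show ?thesis by (rule eventually_mono) (use False assms in \<open>simp add: before_def\<close>)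
qed

text \<open>The determinant vanishes at \<open>d = 0\<close>, so the factor \<open>d\<close> is
  split off; the quotient \<open>G\<close> has the value \<open>(y - x) * h ^ 2 > 0\<close>
  there.\<close>

lemma eventually_det3_pair:
  assumes "x < y" "i \<noteq> l"
  shows "\<forall>\<^sub>F d in at_right 0. det3 (cluster_pt f d (i, x)) (cluster_pt f d (i, y)) (cluster_pt f d (l, z)) > 0"
proof -
  define h where "h = real l - real i"
  define G where "G d = (real y - real x) * (h ^ 2 + 2 * h * d * real z + d ^ 2 * f z - d ^ 2 * f x)
    - d * (h + d * real z - d * real x) * (f y - f x)" for d
  have "\<forall>\<^sub>F d in at_right 0. G d > 0"
  proof (rule eventually_at_right_pos)
    show "isCont G 0" unfolding G_def by (intro continuous_intros)
    show "G 0 > 0" using assms by (simp add: G_def h_def)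
  qed
  moreover have "\<forall>\<^sub>F d in at_right (0::real). d > 0" by (rule eventually_at_right_less)
  ultimately show ?thesis
  proof eventually_elim
    case (elim d)
    have "det3 (cluster_pt f d (i, x)) (cluster_pt f d (i, y)) (cluster_pt f d (l, z)) = d * G d"
      by (simp add: det3_def G_def h_def algebra_simps power2_eq_square)
    then show ?case using elim by simp
  qed
qed

text \<open>Two points in one cluster reduce to \<open>eventually_det3_pair\<close>. For three
  different clusters the limit is the Vandermonde determinant of three points on the
  parabola.\<close>

lemma eventually_det3_sorted:
  assumes "before u v" "before v w" "fst u \<noteq> fst w"
  shows "\<forall>\<^sub>F d in at_right 0. det3 (cluster_pt f d u) (cluster_pt f d v) (cluster_pt f d w) > 0"
proof -
  obtain i x j y l z where uvw: "u = (i, x)" "v = (j, y)" "w = (l, z)" by (cases u; cases v; cases w) blast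
  consider "i = j" "x < y" "i \<noteq> l" | "j = l" "y < z" "j \<noteq> i" | "i < j" "j < l"
    using assms uvw by (fastforce simp: before_def)
  then show ?thesis
  proof cases
    case 1
    then show ?thesis using eventually_det3_pair[of x y i l f z] uvw by simp
  next
    case 2
    then show ?thesis
      using eventually_det3_pair[of y z j i f x] uvw plane.cyc[of "cluster_pt f _ u"] by simp
  next
    case 3
    show ?thesis
    proof (rule eventually_at_right_pos)
      show "isCont (\<lambda>d. det3 (cluster_pt f d u) (cluster_pt f d v) (cluster_pt f d w)) 0"
        unfolding det3_def cluster_pt_nth by (intro continuous_intros)
      have "det3 (cluster_pt f 0 u) (cluster_pt f 0 v) (cluster_pt f 0 w) =
          (real j - real i) * (real l - real i) * (real l - real j)"
        by (simp add: det3_def uvw algebra_simps power2_eq_square)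
      also have "\<dots> > 0" using 3 by (intro mult_pos_pos) auto
      finally show "det3 (cluster_pt f 0 u) (cluster_pt f 0 v) (cluster_pt f 0 w) > 0" .
    qed
  qed
qed

lemma clusters_exist: "\<exists>f pt \<kappa>. clusters t s q f pt \<kappa>"
proof -
  obtain f where f: "horton q f" using horton_exists by blast
  let ?I = "idx t s q"
  have "\<forall>\<^sub>F d in at_right 0. before u v \<longrightarrow> cluster_pt f d u $ 1 < cluster_pt f d v $ 1" for u v
    using eventually_x_mono[of u v f] by (cases "before u v") simp_all
  then have "\<forall>\<^sub>F d in at_right 0. \<forall>u\<in>?I. \<forall>v\<in>?I. before u v \<longrightarrow> cluster_pt f d u $ 1 < cluster_pt f d v $ 1"
    by (intro eventually_ball_finite ballI finite_idx)
  moreover have "\<forall>\<^sub>F d in at_right 0. before u v \<and> before v w \<and> fst u \<noteq> fst w \<longrightarrow>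
      det3 (cluster_pt f d u) (cluster_pt f d v) (cluster_pt f d w) > 0" for u v w
  proof (cases "before u v \<and> before v w \<and> fst u \<noteq> fst w")
    case True
    then show ?thesis using eventually_det3_sorted[of u v w f] by simp
  next
    case False
    then show ?thesis by (intro always_eventually allI impI) blast
  qed
  then have "\<forall>\<^sub>F d in at_right 0. \<forall>u\<in>?I. \<forall>v\<in>?I. \<forall>w\<in>?I. before u v \<and> before v w \<and> fst u \<noteq> fst w \<longrightarrow>
      det3 (cluster_pt f d u) (cluster_pt f d v) (cluster_pt f d w) > 0"
    by (intro eventually_ball_finite ballI finite_idx)
  moreover have "\<forall>\<^sub>F d in at_right (0::real). d > 0" by (rule eventually_at_right_less)
  ultimately have "\<forall>\<^sub>F d in at_right 0. clusters t s q f (cluster_pt f d) (d ^ 3)"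
  proof eventually_elim
    case (elim d)
    show ?case
    proof
      show "horton q f" by (rule f)
      show "d ^ 3 > 0" using elim by simp
    qed (use elim det3_cluster_pt_same in \<open>blast+\<close>)
  qed
  then show ?thesis using eventually_happens'[OF trivial_limit_at_right_real] by blast
qed

section \<open>Bounds for the maximum\<close>

lemma lower_bound_points:
  assumes "3 * t + s \<ge> 6"
  shows "\<exists>P. finite P \<and> general_position P \<and> card P = t * 2 ^ q + s \<and> holes (3 * t + s + 1) P = {} \<and>
    (2 ^ (q - 1) - 1) ^ t \<le> card (holes (3 * t + s) P)"
proof -
  obtain f pt \<kappa> where "clusters t s q f pt \<kappa>" using clusters_exist by blast
  from clusters.holes_lower[OF this assms] show ?thesis by blast
qed

lemma max_holes_ge:
  assumes "finite P" "general_position P" "card P \<le> n" "holes (k + 1) P = {}"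
  shows "card (holes k P) \<le> max_holes k n"
  unfolding max_holes_def
  using assms by (intro Max_ge[OF finite_hole_counts]) (auto simp: hole_counts_def)

lemma max_holes_lower:
  assumes "n > k" "k \<ge> 6" and t: "t = k div 3"
  shows "(1 / 10 / real k) ^ t * real n ^ t \<le> real (max_holes k n)"
proof (cases "n < 2 * k")
  case True
  \<comment> \<open>Without Horton clusters, the \<open>k\<close> single points form an empty convex
    \<open>k\<close>-gon. One hole is enough here, since the left-hand side is at most 1.\<close>
  obtain P :: "(real^2) set" where P: "finite P" "general_position P" "card P = k" "holes (k + 1) P = {}"
    "1 \<le> card (holes k P)"
    using lower_bound_points[of 0 k 0] assms(2) by auto
  then have "1 \<le> max_holes k n" using max_holes_ge[of P n k] assms(1) by simp
  moreover have "(1 / 10 / real k * real n) ^ t \<le> 1"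
    using True assms(2) by (intro power_le_one) (auto simp: field_simps)
  ultimately show ?thesis unfolding power_mult_distrib[symmetric] by linarith
next
  case False
  define s where "s = k mod 3"
  have k: "k = 3 * t + s" and s: "s \<le> 2" using t by (auto simp: s_def)
  have t2: "t \<ge> 2" using assms(2) t by simp
  \<comment> \<open>\<open>Q\<close> holds the cluster exponents that fit into \<open>n\<close>
    points. Its maximum \<open>q\<close> bounds \<open>n\<close> from above, and
    \<open>n \<ge> 2 * k\<close> ensures \<open>q \<ge> 2\<close>.\<close>
  define Q where "Q = {q. t * 2 ^ q + s \<le> n}"
  have "Q \<subseteq> {..n}"
  proof
    fix q assume "q \<in> Q"
    then have "t * 2 ^ q \<le> n" by (simp add: Q_def)
    moreover have "1 * q \<le> t * 2 ^ q" using t2 by (intro mult_le_mono) (auto intro: less_imp_le)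
    ultimately show "q \<in> {..n}" by simp
  qed
  then have fin: "finite Q" using finite_subset by blast
  have Q2: "2 \<in> Q" using False k t2 s by (simp add: Q_def)
  define q where "q = Max Q"
  have q: "q \<in> Q" "2 \<le> q" using Max_in[OF fin] Max_ge[OF fin Q2] Q2 unfolding q_def by blast+
  have "Suc q \<notin> Q" using Max_ge[OF fin, of "Suc q"] by (auto simp: q_def)
  then have n: "n < t * 2 ^ Suc q + s" by (simp add: Q_def)
  obtain P :: "(real^2) set" where P: "finite P" "general_position P" "card P = t * 2 ^ q + s" "holes (k + 1) P = {}"
    "(2 ^ (q - 1) - 1) ^ t \<le> card (holes k P)"
    using lower_bound_points[of t s q] assms(2) k by auto
  have "card (holes k P) \<le> max_holes k n" using max_holes_ge[of P n k] P q by (simp add: Q_def)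
  then have m: "(2 ^ (q - 1) - 1) ^ t \<le> max_holes k n" using P(5) by simp
  obtain r where r: "q = Suc (Suc r)" using q(2) by (metis Suc_le_D numeral_2_eq_2 Suc_le_mono)
  have "n < 8 * (t * 2 ^ r) + s" using n r by simp
  then have "n < 8 * (t * 2 ^ r) + 2" using s by linarith
  then have "real n < real (8 * (t * 2 ^ r) + 2)" by (simp only: of_nat_less_iff)
  then have "real n < 8 * (real t * 2 ^ r) + 2" by simp
  \<comment> \<open>The 10 is 8 + 2: \<open>2 ^ Suc q = 8 * 2 ^ r\<close>, and the at most two
    single points are absorbed because \<open>t * 2 ^ r \<ge> 1\<close>.\<close>
  moreover have "real t * 2 ^ r \<ge> 1 * 1" using t2 by (intro mult_mono) auto
  ultimately have "real n \<le> 10 * (real t * 2 ^ r)" by simp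
  also have "\<dots> \<le> 10 * (real k * 2 ^ r)" using k by (intro mult_left_mono mult_right_mono) auto
  finally have "1 / 10 / real k * real n \<le> 2 ^ r" using assms(2) by (simp add: field_simps)
  also have "(2::real) ^ r \<le> real (2 ^ (q - 1) - 1)" using r by (simp add: of_nat_diff)
  finally have "(1 / 10 / real k * real n) ^ t \<le> real (2 ^ (q - 1) - 1) ^ t"
    by (intro power_mono) auto
  also have "\<dots> = real ((2 ^ (q - 1) - 1) ^ t)" by (rule of_nat_power[symmetric])
  also have "\<dots> \<le> real (max_holes k n)" using m by (simp only: of_nat_le_iff)
  finally show ?thesis unfolding power_mult_distrib[symmetric] .
qed

lemma max_holes_upper:
  assumes "k \<ge> 5" and r: "r = (k + 1) div 2"
  shows "real (max_holes k n) \<le> (12 / real k) ^ r * real n ^ r"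
proof -
  have "max_holes k n \<in> hole_counts k n"
    unfolding max_holes_def by (rule Max_in[OF finite_hole_counts hole_counts_nonempty])
  then obtain P where P: "finite P" "general_position P" "card P \<le> n" "holes (k + 1) P = {}"
    "max_holes k n = card (holes k P)" by (auto simp: hole_counts_def)
  have "real (max_holes k n) \<le> real (2 * (r * (card P choose r)))"
    using card_holes_le[OF P(1,2) assms(1) P(4)] P(5) r by (simp only: of_nat_le_iff)
  also have "\<dots> \<le> (12 / real k) ^ r * real n ^ r" by (rule upper_bound_arith[OF assms(1) P(3) r])
  finally show ?thesis .
qed

theorem theorem1p1:
  "\<exists>c1 c2 :: real. c1 > 0 \<and> c2 > 0 \<and>
     (\<forall>n k :: nat. n > k \<and> k \<ge> 6 \<longrightarrow>
        (c1 / real k) ^ nat \<lfloor>real k / 3\<rfloor> * real n ^ nat \<lfloor>real k / 3\<rfloor> \<le> real (max_holes k n) \<and>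
        real (max_holes k n) \<le> (c2 / real k) ^ nat \<lceil>real k / 2\<rceil> * real n ^ nat \<lceil>real k / 2\<rceil>)"
proof (rule exI[of _ "1 / 10"], rule exI[of _ 12], intro conjI allI impI)
  fix n k :: nat assume nk: "n > k \<and> k \<ge> 6"
  have "\<lfloor>real k / 3\<rfloor> = int (k div 3)" using floor_divide_of_nat_eq[of k 3] by simp
  then have 3: "nat \<lfloor>real k / 3\<rfloor> = k div 3" by simp
  have "\<lceil>real k / 2\<rceil> = int ((k + 1) div 2)"
    by (cases "even k") (auto elim!: evenE oddE intro!: ceiling_unique)
  then have 2: "nat \<lceil>real k / 2\<rceil> = (k + 1) div 2" by simp
  show "(1 / 10 / real k) ^ nat \<lfloor>real k / 3\<rfloor> * real n ^ nat \<lfloor>real k / 3\<rfloor> \<le> real (max_holes k n)"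
    using max_holes_lower[of k n] nk 3 by simp
  show "real (max_holes k n) \<le> (12 / real k) ^ nat \<lceil>real k / 2\<rceil> * real n ^ nat \<lceil>real k / 2\<rceil>"
    using max_holes_upper[of k] nk 2 by simp
qed simp_all

end
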